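(* Let $(R,\mathfrak m)$ be a Noetherian local ring. Then $I\mapsto I^{-\mathrm{sp}}$ is a special part of integral closure (of ideals of $R$). That is, for all ideals $J,I$ of $R$: (1) $I^{-\mathrm{sp}}$ is an ideal of $R$; (2) $\mathfrak m I\subseteq I^{-\mathrm{sp}}\subseteq\overline I$; (3) $(\overline I)^{-\mathrm{sp}}=I^{-\mathrm{sp}}=\overline{I^{-\mathrm{sp}}}$; (4) if $J\subseteq I\subseteq\overline{J+I^{-\mathrm{sp}}}$, then $I\subseteq\overline J$.
   Context: $\overline{A}$ denotes the integral closure of an ideal $A$. For an ideal $I$ of a Noetherian local ring $(R,\mathfrak m)$, the special part of the integral closure of $I$ is $I^{-\mathrm{sp}}:=\{x\in R : \exists\, n\ge1 \text{ such that } x^n\in\overline{\mathfrak m I^n}\}$. *)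

theory Defs
  imports "HOL-Algebra.Ring_Divisibility" "HOL-Algebra.Ideal_Product"
begin

locale local_ring = cring R for R (structure) and \<mm> +
  assumes maximalideal_max: "maximalideal \<mm> R"
    and maximalideal_unique: "maximalideal N R \<Longrightarrow> N = \<mm>"

locale noetherian_local_ring = local_ring R \<mm> + noetherian_ring R
  for R (structure) and \<mm>

text \<open>The power of an ideal is its power in the multiplicative monoid of ideals; in particular
  the zeroth power of any ideal is the whole ring.\<close>

abbreviation ideal_pow :: "('a, 'b) ring_scheme \<Rightarrow> 'a set \<Rightarrow> nat \<Rightarrow> 'a set"
  where "ideal_pow R I n \<equiv> I [^]\<^bsub>ideals_set R\<^esub> n"

text \<open>Integral closure in the sense of equations of integral dependence over \<open>I\<close>.\<close>

definition integral_closure :: "('a, 'b) ring_scheme \<Rightarrow> 'a set \<Rightarrow> 'a set"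
  where "integral_closure R I =
    {x \<in> carrier R. \<exists>n \<ge> (1::nat). \<exists>a :: nat \<Rightarrow> 'a.
       (\<forall>i \<in> {1..n}. a i \<in> ideal_pow R I i) \<and>
       x [^]\<^bsub>R\<^esub> n \<oplus>\<^bsub>R\<^esub> (\<Oplus>\<^bsub>R\<^esub>i\<in>{1..n}. a i \<otimes>\<^bsub>R\<^esub> x [^]\<^bsub>R\<^esub> (n - i)) = \<zero>\<^bsub>R\<^esub>}"

definition integral_closure_sp :: "('a, 'b) ring_scheme \<Rightarrow> 'a set \<Rightarrow> 'a set \<Rightarrow> 'a set"
  where "integral_closure_sp R \<mm> I =
    {x \<in> carrier R. \<exists>n \<ge> (1::nat).
       x [^]\<^bsub>R\<^esub> n \<in> integral_closure R (\<mm> \<cdot>\<^bsub>R\<^esub> ideal_pow R I n)}"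

text \<open>Here \<open>cl\<close> is meant to be a closure operation on the ideals of \<open>R\<close>; this is not part of
  the predicate. Both \<open>cl\<close> and \<open>sp\<close> are constrained only on ideals.\<close>

definition special_part ::
    "('a, 'b) ring_scheme \<Rightarrow> 'a set \<Rightarrow> ('a set \<Rightarrow> 'a set) \<Rightarrow> ('a set \<Rightarrow> 'a set) \<Rightarrow> bool"
  where "special_part R \<mm> cl sp \<longleftrightarrow>
    (\<forall>I. ideal I R \<longrightarrow> ideal (sp I) R) \<and>
    (\<forall>I. ideal I R \<longrightarrow> \<mm> \<cdot>\<^bsub>R\<^esub> I \<subseteq> sp I \<and> sp I \<subseteq> cl I) \<and>
    (\<forall>I. ideal I R \<longrightarrow> sp (cl I) = sp I \<and> sp I = cl (sp I)) \<and>
    (\<forall>J I. ideal J R \<longrightarrow> ideal I R \<longrightarrow>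
       J \<subseteq> I \<longrightarrow> I \<subseteq> cl (J <+>\<^bsub>R\<^esub> sp I) \<longrightarrow> I \<subseteq> cl J)"

end

(* Call I a reduction of L when I L^n = L^(n+1) for some n. Over a Noetherian ring this means
   I <= L <= cl I, by the determinant trick; so reductions of the closures can be multiplied and
   composed, and integral closures become manageable through products of ideals only.

   The elements x of I^sp satisfy x^n : cl(m I^n) with a common exponent: S = I^sp is finitely
   generated, hence S^N <= cl(m I^N) for some N, and (1)-(3) follow.

   For (4), J + S is a reduction of K = cl I, which gives K^Q <= J K^(Q-1) + D with D = cl(m I^Q).
   As m I^Q is a reduction of D and I^Q is a reduction of E = cl(I^Q), taking a power and multiplying
   by a power of E leads to K W <= J W + m K W for an ideal W containing a power of every element
   of K. Nakayama's lemma gives K W <= J W, and the determinant trick K <= cl J. *)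

theory Submission
  imports Defs
begin

text \<open>The ring may have zero divisors and nilpotents, so an ideal W with K W \<subseteq> J W
  need not be a faithful module: the determinant trick only yields an element z^(k+1) - g that kills
  W. A power z^N inside W replaces faithfulness, because z^(k+1+N) = g z^N is already a relation of
  integral dependence for z. The delicate point in (4) is that D is an integral closure and need not
  lie in \<mm> K^Q, so Nakayama's lemma does not apply to K^Q \<subseteq> J K^(Q-1) + D as it
  stands. A factor \<mm> comes out only of a high power D^(p+1), and it leaves behind factors in
  E^p, which need not lie in K^(Qp). Multiplication by E^r repairs this: since I^Q is a reduction of
  E, a suitable r gives E^(p+r) \<subseteq> I^(Qp) E^r, so the leftover factors are absorbed by one
  fixed ideal.\<close>

no_notation Sum_Type.Plus (infixr \<open><+>\<close> 65)

section \<open>Arithmetic of ideals\<close>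

context cring
begin

lemma ideal_prod_subsetI:
  assumes "ideal C R" "\<And>a b. a \<in> A \<Longrightarrow> b \<in> B \<Longrightarrow> a \<otimes> b \<in> C"
  shows "A \<cdot> B \<subseteq> C"
proof
  fix s assume "s \<in> A \<cdot> B"
  then show "s \<in> C"
    by induct (auto simp: assms additive_subgroup.a_closed ideal.axioms(1))
qed

lemma ideal_prod_mono:
  assumes "A \<subseteq> A'" "B \<subseteq> B'"
  shows "A \<cdot> B \<subseteq> A' \<cdot> B'"
proof
  fix s assume "s \<in> A \<cdot> B"
  then show "s \<in> A' \<cdot> B'"
    by induct (use assms in \<open>auto intro: ideal_prod.intros\<close>)
qed

lemma set_add_subset_iff:
  assumes "ideal A R" "ideal B R" "ideal C R"
  shows "A <+> B \<subseteq> C \<longleftrightarrow> A \<subseteq> C \<and> B \<subseteq> C"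
proof -
  have "A \<union> B \<subseteq> carrier R"
    using assms by (auto intro: ideal.Icarr)
  then show ?thesis
    using Idl_subset_ideal[OF assms(3), of "A \<union> B"] union_genideal[OF assms(1,2)] by simp
qed

lemma mem_set_addE:
  assumes "x \<in> A <+> B"
  obtains a b where "a \<in> A" "b \<in> B" "x = a \<oplus> b"
  using assms unfolding set_add_def' by blast

lemma set_add_mono:
  assumes "A \<subseteq> A'" "B \<subseteq> B'"
  shows "A <+> B \<subseteq> A' <+> B'"
  using assms by (auto simp: set_add_def')

lemma subset_set_add:
  assumes "ideal A R" "ideal B R"
  shows "A \<subseteq> A <+> B" "B \<subseteq> A <+> B"
  using set_add_subset_iff[OF assms add_ideals[OF assms]] by auto

lemma cgenideal_subset_iff:
  assumes "ideal C R" "x \<in> carrier R"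
  shows "PIdl x \<subseteq> C \<longleftrightarrow> x \<in> C"
  using assms cgenideal_minimal cgenideal_self by blast

text \<open>The induction step for finitely generated ideals: every later argument by generators
  adjoins or removes one principal ideal through this equation.\<close>

lemma Idl_insert:
  assumes "x \<in> carrier R" "F \<subseteq> carrier R"
  shows "Idl (insert x F) = Idl F <+> PIdl x"
proof
  note ideals = genideal_ideal[OF assms(2)] cgenideal_ideal[OF assms(1)]
  show "Idl (insert x F) \<subseteq> Idl F <+> PIdl x"
    using subset_set_add[OF ideals] genideal_self[OF assms(2)] cgenideal_self[OF assms(1)]
    by (intro genideal_minimal add_ideals ideals) auto
  have "ideal (Idl (insert x F)) R"
    using assms by (intro genideal_ideal) auto
  moreover have "insert x F \<subseteq> Idl (insert x F)"
    using assms by (intro genideal_self) auto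
  ultimately show "Idl F <+> PIdl x \<subseteq> Idl (insert x F)"
    using ideals assms by (auto simp: set_add_subset_iff cgenideal_subset_iff genideal_minimal)
qed

text \<open>With a principal factor the sums of products collapse to one term, because
  \<open>A\<close> absorbs the multipliers of \<open>x\<close> and is closed under addition.\<close>

lemma mem_ideal_prod_cgenideal:
  assumes "ideal A R" "x \<in> carrier R" "y \<in> A \<cdot> (PIdl x)"
  obtains a where "a \<in> A" "y = a \<otimes> x"
proof -
  have "A \<cdot> (PIdl x) \<subseteq> {a \<otimes> x | a. a \<in> A}"
  proof
    fix s assume "s \<in> A \<cdot> (PIdl x)"
    then show "s \<in> {a \<otimes> x | a. a \<in> A}"
    proof induct
      case (prod i j)
      then obtain r where "r \<in> carrier R" "j = r \<otimes> x"
        by (auto simp: cgenideal_def)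
      moreover from prod \<open>r \<in> carrier R\<close> have "i \<otimes> r \<in> A"
        using assms(1) by (simp add: ideal.I_r_closed)
      moreover have "i \<otimes> (r \<otimes> x) = (i \<otimes> r) \<otimes> x"
        using prod(1) \<open>r \<in> carrier R\<close> assms(1,2) ideal.Icarr m_assoc by metis
      ultimately show ?case by auto
    next
      case (sum s1 s2)
      then obtain a b where "a \<in> A" "b \<in> A" "s1 = a \<otimes> x" "s2 = b \<otimes> x" by auto
      moreover have "a \<oplus> b \<in> A"
        using \<open>a \<in> A\<close> \<open>b \<in> A\<close> assms(1) by (simp add: additive_subgroup.a_closed ideal.axioms(1))
      moreover have "(a \<oplus> b) \<otimes> x = a \<otimes> x \<oplus> b \<otimes> x"
        using \<open>a \<in> A\<close> \<open>b \<in> A\<close> assms(1,2) ideal.Icarr l_distr by metis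
      ultimately show ?case unfolding mem_Collect_eq by metis
    qed
  qed
  then show ?thesis using assms(3) that by auto
qed

lemma ideal_prod_left_commute:
  assumes "ideal A R" "ideal B R" "ideal C R"
  shows "A \<cdot> (B \<cdot> C) = B \<cdot> (A \<cdot> C)"
  by (metis assms ideal_prod_assoc ideal_prod_commute)

lemmas ideal_prod_ac = ideal_prod_assoc ideal_prod_commute ideal_prod_left_commute

section \<open>Powers of ideals and the expansion of powers of a sum\<close>

text \<open>Exposes the commutative monoid of ideals, so that the laws for powers of ideals are
  inherited from those of monoids.\<close>

lemma ideals_set_simps [simp]:
  "carrier (ideals_set R) = {I. ideal I R}"
  "mult (ideals_set R) = ideal_prod R"
  "one (ideals_set R) = carrier R"
  by (simp_all add: ideals_set_def)

lemma ideal_pow_ideal: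
  assumes "ideal I R"
  shows "ideal (ideal_pow R I n) R"
  using monoid.nat_pow_closed[OF comm_monoid.axioms(1)[OF ideals_set_is_comm_monoid], of I n] assms
  by simp

lemma ideal_pow_1:
  assumes "ideal I R"
  shows "ideal_pow R I (1::nat) = I"
  using assms by (simp add: ideal_prod_one oneideal ideal_prod_commute[of "carrier R"])

lemma ideal_pow_add:
  assumes "ideal I R"
  shows "ideal_pow R I (m + n) = ideal_pow R I m \<cdot> ideal_pow R I n"
  using monoid.nat_pow_mult[OF comm_monoid.axioms(1)[OF ideals_set_is_comm_monoid], of I m n] assms
  by simp

lemma ideal_pow_mult:
  assumes "ideal I R"
  shows "ideal_pow R I (m * n) = ideal_pow R (ideal_pow R I m) n"
  using monoid.nat_pow_pow[OF comm_monoid.axioms(1)[OF ideals_set_is_comm_monoid], of I m n] assms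
  by simp

lemma ideal_pow_ideal_prod:
  assumes "ideal I R" "ideal J R"
  shows "ideal_pow R (I \<cdot> J) n = ideal_pow R I n \<cdot> ideal_pow R J n"
  using comm_monoid.nat_pow_distrib[OF ideals_set_is_comm_monoid, of I J n] assms
  by simp

lemma ideal_pow_mono:
  assumes "I \<subseteq> J"
  shows "ideal_pow R I n \<subseteq> ideal_pow R J (n::nat)"
  by (induct n) (simp_all add: ideal_prod_mono assms)

lemma nat_pow_mem_ideal_pow:
  assumes "x \<in> I"
  shows "x [^] n \<in> ideal_pow R I (n::nat)"
  by (induct n) (simp_all add: ideal_prod.prod assms)

lemma ideal_prod_subset:
  assumes "ideal A R" "ideal B R"
  shows "A \<cdot> B \<subseteq> A" "A \<cdot> B \<subseteq> B"
  using ideal_prod_inter[OF assms] by auto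

lemmas ideal_intros = ideal_prod_is_ideal add_ideals ideal_pow_ideal cgenideal_ideal

lemma finsum_mem_ideal:
  assumes "ideal I R" "finite A" "\<And>i. i \<in> A \<Longrightarrow> f i \<in> I"
  shows "(\<Oplus>i\<in>A. f i) \<in> I"
  using assms(2,3)
proof (induct A)
  case empty
  then show ?case
    using assms(1) by (simp add: additive_subgroup.zero_closed ideal.axioms(1))
next
  case (insert x A)
  then have "f \<in> A \<rightarrow> carrier R" "f x \<in> carrier R"
    using ideal.Icarr[OF assms(1)] by auto
  with insert assms(1) show ?case
    by (simp add: additive_subgroup.a_closed ideal.axioms(1))
qed

text \<open>When (A + B)^(n+1) is expanded, B^(n+1) is the only term without a factor from
  \<open>A\<close>. In the applications the first summand carries the wanted factor and a high power
  of the second is controlled by other means.\<close>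

lemma ideal_pow_add_Suc_subset:
  assumes "ideal A R" "ideal B R"
  shows "ideal_pow R (A <+> B) (Suc n) \<subseteq> ideal_pow R (A <+> B) n \<cdot> A <+> ideal_pow R B (Suc n)"
    (is "ideal_pow R ?L _ \<subseteq> _")
proof (induct n)
  case 0
  show ?case
    using assms set_add_comm[of A B]
    by (simp add: ideal_prod_one oneideal ideal_prod_commute[of "carrier R"] add_ideals)
next
  case (Suc n)
  let ?C = "ideal_pow R ?L (Suc n) \<cdot> A <+> ideal_pow R B (Suc (Suc n))"
  have C: "ideal ?C R" and L: "ideal ?L R"
    using assms by (auto intro!: ideal_intros simp del: nat_pow_Suc)
  have sub: "ideal_pow R ?L (Suc n) \<cdot> A \<subseteq> ?C" "ideal_pow R B (Suc n) \<cdot> B \<subseteq> ?C"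
    using assms subset_set_add[of "ideal_pow R ?L (Suc n) \<cdot> A" "ideal_pow R B (Suc (Suc n))"]
    by (auto intro!: ideal_intros)
  have "ideal_pow R ?L (Suc n) \<cdot> B \<subseteq> (ideal_pow R ?L n \<cdot> A <+> ideal_pow R B (Suc n)) \<cdot> B"
    using Suc by (intro ideal_prod_mono order_refl)
  also have "\<dots> = (ideal_pow R ?L n \<cdot> B) \<cdot> A <+> ideal_pow R B (Suc n) \<cdot> B"
    using assms L ideal_pow_ideal[OF assms(2), of "Suc n"]
    by (simp add: ideal_prod_distr ideal_intros ideal_prod_ac del: nat_pow_Suc)
  also have "\<dots> \<subseteq> ?C"
  proof -
    have "(ideal_pow R ?L n \<cdot> B) \<cdot> A \<subseteq> ideal_pow R ?L (Suc n) \<cdot> A"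
      using subset_set_add[OF assms] by (simp add: ideal_prod_mono)
    then show ?thesis
      using sub assms C L by (subst set_add_subset_iff) (auto intro!: ideal_intros simp del: nat_pow_Suc)
  qed
  finally have "ideal_pow R ?L (Suc n) \<cdot> B \<subseteq> ?C" .
  then have "ideal_pow R ?L (Suc n) \<cdot> A <+> ideal_pow R ?L (Suc n) \<cdot> B \<subseteq> ?C"
    using sub assms C L by (subst set_add_subset_iff) (auto intro!: ideal_intros simp del: nat_pow_Suc)
  moreover have "ideal_pow R ?L (Suc (Suc n)) = ideal_pow R ?L (Suc n) \<cdot> A <+> ideal_pow R ?L (Suc n) \<cdot> B"
    using ideal_prod_distr(1)[OF ideal_pow_ideal[OF L, of "Suc n"] assms] by simp
  ultimately show ?case by simp
qed

text \<open>A pigeonhole argument: a product of i + n factors from A + B expands into terms with at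
  least i factors from \<open>A\<close> or at least n from \<open>B\<close>. In the induction on
  \<open>i\<close>, the part containing A^i is expanded once more to gain a further factor of either
  kind.\<close>

lemma ideal_pow_add_subset:
  assumes "ideal A R" "ideal B R"
  shows "ideal_pow R (A <+> B) (i + n)
    \<subseteq> ideal_pow R (A <+> B) n \<cdot> ideal_pow R A i <+> ideal_pow R (A <+> B) i \<cdot> ideal_pow R B n"
    (is "ideal_pow R ?L _ \<subseteq> _")
proof (induct i)
  case 0
  have "ideal_pow R ?L n \<subseteq> ideal_pow R ?L n <+> carrier R \<cdot> ideal_pow R B n"
    using assms by (intro subset_set_add ideal_intros oneideal)
  then show ?case
    using assms by (simp add: ideal_prod_one ideal_intros)
next
  case (Suc i)
  let ?C = "ideal_pow R ?L n \<cdot> ideal_pow R A (Suc i) <+> ideal_pow R ?L (Suc i) \<cdot> ideal_pow R B n"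
  have L: "ideal ?L R" using assms by (intro ideal_intros)
  have I: "ideal (ideal_pow R A m) R" "ideal (ideal_pow R B m) R" "ideal (ideal_pow R ?L m) R" for m :: nat
    using assms L by (auto intro: ideal_intros)
  note I' = I[of "Suc _"]
  have C: "ideal ?C R"
    using assms by (intro ideal_intros)
  have sub: "ideal_pow R ?L n \<cdot> ideal_pow R A (Suc i) \<subseteq> ?C" "ideal_pow R ?L (Suc i) \<cdot> ideal_pow R B n \<subseteq> ?C"
    using subset_set_add[of "ideal_pow R ?L n \<cdot> ideal_pow R A (Suc i)" "ideal_pow R ?L (Suc i) \<cdot> ideal_pow R B n"]
      assms I by (auto intro!: ideal_intros simp del: nat_pow_Suc)
  have "ideal_pow R ?L (Suc n) \<cdot> ideal_pow R A i
      \<subseteq> (ideal_pow R ?L n \<cdot> A <+> ideal_pow R B (Suc n)) \<cdot> ideal_pow R A i"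
    using ideal_pow_add_Suc_subset[OF assms] by (intro ideal_prod_mono order_refl)
  also have "\<dots> = ideal_pow R ?L n \<cdot> ideal_pow R A (Suc i) <+> (ideal_pow R A i \<cdot> B) \<cdot> ideal_pow R B n"
    using assms I by (simp add: ideal_prod_distr ideal_intros ideal_prod_ac)
  also have "\<dots> \<subseteq> ?C"
  proof -
    have "(ideal_pow R A i \<cdot> B) \<cdot> ideal_pow R B n \<subseteq> ideal_pow R ?L (Suc i) \<cdot> ideal_pow R B n"
      using subset_set_add[OF assms] by (simp add: ideal_prod_mono ideal_pow_mono)
    then show ?thesis
      using sub assms C I I' by (subst set_add_subset_iff) (auto intro!: ideal_prod_is_ideal simp del: nat_pow_Suc)
  qed
  finally have "ideal_pow R ?L (Suc n) \<cdot> ideal_pow R A i <+> ideal_pow R ?L (Suc i) \<cdot> ideal_pow R B n \<subseteq> ?C"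
    using sub C I I' L by (subst set_add_subset_iff) (auto intro!: ideal_prod_is_ideal simp del: nat_pow_Suc)
  moreover have "ideal_pow R ?L (Suc i + n) = ideal_pow R ?L (i + n) \<cdot> ?L"
    by simp
  moreover have "ideal_pow R ?L (i + n) \<cdot> ?L
      \<subseteq> (ideal_pow R ?L n \<cdot> ideal_pow R A i <+> ideal_pow R ?L i \<cdot> ideal_pow R B n) \<cdot> ?L"
    using Suc by (intro ideal_prod_mono order_refl)
  moreover have "\<dots> = ideal_pow R ?L (Suc n) \<cdot> ideal_pow R A i <+> ideal_pow R ?L (Suc i) \<cdot> ideal_pow R B n"
    using assms I L by (simp add: ideal_prod_distr ideal_prod_is_ideal ideal_prod_ac)
  ultimately show ?case by auto
qed

section \<open>Integral dependence as membership in a product of ideals\<close>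

text \<open>Recovers the coefficients of an integral equation of degree n + 1 from membership in a
  product of ideals: the terms of I (I + (x))^n are sorted by the power of x that they contain, and
  the complementary factors come from \<open>I\<close>.\<close>

lemma mem_ideal_prod_pow_adjoin:
  assumes "ideal I R" "x \<in> carrier R" "y \<in> I \<cdot> ideal_pow R (I <+> PIdl x) n"
  shows "\<exists>a. (\<forall>i \<in> {1..Suc n}. a i \<in> ideal_pow R I i) \<and>
    y = (\<Oplus>i\<in>{1..Suc n}. a i \<otimes> x [^] (Suc n - i))"
  using assms(3)
proof (induct n arbitrary: y)
  case 0
  then have y: "y \<in> I" using assms(1) by (simp add: ideal_prod_one)
  then have "y \<in> carrier R" using assms(1) ideal.Icarr by metis
  then show ?case
    using y ideal_pow_1[OF assms(1)] by (intro exI[of _ "\<lambda>_. y"]) simp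
next
  case (Suc n)
  let ?L = "PIdl x <+> I"
  have X: "ideal (PIdl x) R" using assms by (intro ideal_intros)
  \<comment> \<open>The sum is turned around because \<open>ideal_pow_add_Suc_subset\<close>
    isolates the power of its second summand, which has to be \<open>I\<close> here; the other part
    is then divisible by x.\<close>
  have comm: "I <+> PIdl x = ?L"
    using set_add_comm[of I "PIdl x"] assms X by (meson ideal.Icarr subsetI)
  have L: "ideal ?L R" using assms X by (intro ideal_intros)
  have I: "ideal (ideal_pow R ?L m) R" "ideal (ideal_pow R I m) R" for m :: nat
    using L assms by (auto intro: ideal_intros)
  have "y \<in> I \<cdot> ideal_pow R ?L (Suc n)"
    using Suc.prems comm by simp
  also have "\<dots> \<subseteq> I \<cdot> (ideal_pow R ?L n \<cdot> (PIdl x) <+> ideal_pow R I (Suc n))"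
    using ideal_pow_add_Suc_subset[OF X assms(1)] by (intro ideal_prod_mono order_refl)
  also have "\<dots> = (I \<cdot> ideal_pow R ?L n) \<cdot> (PIdl x) <+> ideal_pow R I (Suc (Suc n))"
    using assms(1) I X I(2)[of "Suc n"]
    by (simp add: ideal_prod_distr ideal_prod_ac ideal_prod_is_ideal)
  finally obtain u c where "u \<in> (I \<cdot> ideal_pow R ?L n) \<cdot> (PIdl x)"
      and c: "c \<in> ideal_pow R I (Suc (Suc n))" and y: "y = u \<oplus> c"
    by (rule mem_set_addE)
  then obtain v where v: "v \<in> I \<cdot> ideal_pow R ?L n" "u = v \<otimes> x"
    using mem_ideal_prod_cgenideal[of "I \<cdot> ideal_pow R ?L n" x u] assms I by (auto intro: ideal_intros)
  from Suc.hyps[of v] v(1) obtain a where a: "\<And>i. i \<in> {1..Suc n} \<Longrightarrow> a i \<in> ideal_pow R I i"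
      "v = (\<Oplus>i\<in>{1..Suc n}. a i \<otimes> x [^] (Suc n - i))"
    unfolding comm by blast
  have ac: "a i \<in> carrier R" if "i \<in> {1..Suc n}" for i
    using a(1)[OF that] I(2) ideal.Icarr by metis
  have cc: "c \<in> carrier R" using c I(2) ideal.Icarr by metis
  \<comment> \<open>Multiplying the expansion of \<open>v\<close> by x raises each exponent of x and
    keeps the coefficients; \<open>c\<close> becomes the new constant term.\<close>
  define b where "b = a(Suc (Suc n) := c)"
  have "v \<otimes> x = (\<Oplus>i\<in>{1..Suc n}. a i \<otimes> x [^] (Suc n - i) \<otimes> x)"
    unfolding a(2) using ac assms(2) by (subst finsum_ldistr) auto
  also have "\<dots> = (\<Oplus>i\<in>{1..Suc n}. b i \<otimes> x [^] (Suc (Suc n) - i))"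
    using ac assms(2) by (intro finsum_cong') (auto simp: b_def m_assoc Suc_diff_le)
  finally have "y = (\<Oplus>i\<in>{1..Suc n}. b i \<otimes> x [^] (Suc (Suc n) - i)) \<oplus> c"
    using y v by simp
  also have "\<dots> = (\<Oplus>i\<in>insert (Suc (Suc n)) {1..Suc n}. b i \<otimes> x [^] (Suc (Suc n) - i))"
    using ac cc assms(2) by (subst finsum_insert) (auto simp: b_def a_comm intro!: finsum_closed)
  also have "insert (Suc (Suc n)) {1..Suc n} = {1..Suc (Suc n)}" by auto
  finally show ?case
    using a(1) c by (intro exI[of _ b]) (auto simp: b_def)
qed

text \<open>Trades the coefficients of the integral equation for one membership. With L = I + (x),
  each term satisfies a_i x^(n-i) \<in> I^i L^(n-i) \<subseteq> I L^(n-1), so the equation puts x^n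
  in I L^(n-1); conversely such a membership can be expanded into coefficients.\<close>

lemma integral_closure_iff:
  assumes "ideal I R" "x \<in> carrier R"
  shows "x \<in> integral_closure R I \<longleftrightarrow> (\<exists>n. x [^] Suc n \<in> I \<cdot> ideal_pow R (I <+> PIdl x) n)"
    (is "_ \<longleftrightarrow> (\<exists>n. _ \<in> I \<cdot> ideal_pow R ?L n)")
proof
  have X: "ideal (PIdl x) R" using assms by (intro ideal_intros)
  have L: "ideal ?L R" using assms X by (intro ideal_intros)
  have xL: "x \<in> ?L" using subset_set_add(2)[OF assms(1) X] cgenideal_self[OF assms(2)] by auto
  assume "x \<in> integral_closure R I"
  then obtain n a where n: "n \<ge> (1::nat)" and a: "\<And>i. i \<in> {1..n} \<Longrightarrow> a i \<in> ideal_pow R I i"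
    and eq: "x [^] n \<oplus> (\<Oplus>i\<in>{1..n}. a i \<otimes> x [^] (n - i)) = \<zero>"
    unfolding integral_closure_def by blast
  obtain m where m: "n = Suc m" using n by (cases n) auto
  let ?C = "I \<cdot> ideal_pow R ?L m"
  have C: "ideal ?C R" using assms L by (intro ideal_intros)
  have "a i \<otimes> x [^] (n - i) \<in> ?C" if i: "i \<in> {1..n}" for i
  proof -
    obtain j where j: "i = Suc j" using i by (cases i) auto
    have "a i \<otimes> x [^] (n - i) \<in> ideal_pow R I (Suc j) \<cdot> ideal_pow R ?L (m - j)"
      using a[OF i] nat_pow_mem_ideal_pow[OF xL, of "n - i"] m
      by (intro ideal_prod.prod) (auto simp: j)
    also have "\<dots> = I \<cdot> (ideal_pow R I j \<cdot> ideal_pow R ?L (m - j))"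
      using assms L by (simp add: ideal_prod_ac ideal_pow_ideal ideal_prod_is_ideal)
    also have "\<dots> \<subseteq> I \<cdot> (ideal_pow R ?L j \<cdot> ideal_pow R ?L (m - j))"
      using subset_set_add(1)[OF assms(1) X] by (intro ideal_prod_mono ideal_pow_mono) auto
    also have "\<dots> = ?C"
      using i m j L by (simp flip: ideal_pow_add)
    finally show ?thesis .
  qed
  then have sum: "(\<Oplus>i\<in>{1..n}. a i \<otimes> x [^] (n - i)) \<in> ?C"
    by (intro finsum_mem_ideal[OF C]) auto
  then have "x [^] n = \<ominus> (\<Oplus>i\<in>{1..n}. a i \<otimes> x [^] (n - i))"
    using eq assms(2) ideal.Icarr[OF C] by (metis minus_equality nat_pow_closed a_comm)
  then show "\<exists>n. x [^] Suc n \<in> I \<cdot> ideal_pow R ?L n"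
    using sum additive_subgroup.a_inv_closed[OF ideal.axioms(1)[OF C]] m by metis
next
  assume "\<exists>n. x [^] Suc n \<in> I \<cdot> ideal_pow R ?L n"
  then obtain n where n: "x [^] Suc n \<in> I \<cdot> ideal_pow R ?L n" ..
  have C: "ideal (I \<cdot> ideal_pow R ?L n) R" using assms by (intro ideal_intros)
  \<comment> \<open>The negative is expanded so that adding x^(n+1) to the sum gives zero, with the
    signs of the definition.\<close>
  have "\<ominus> (x [^] Suc n) \<in> I \<cdot> ideal_pow R ?L n"
    using n additive_subgroup.a_inv_closed[OF ideal.axioms(1)[OF C]] by blast
  from mem_ideal_prod_pow_adjoin[OF assms this] obtain a
    where "\<forall>i \<in> {1..Suc n}. a i \<in> ideal_pow R I i"
      "\<ominus> (x [^] Suc n) = (\<Oplus>i\<in>{1..Suc n}. a i \<otimes> x [^] (Suc n - i))" by blast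
  moreover have "x [^] Suc n \<oplus> \<ominus> (x [^] Suc n) = \<zero>"
    using assms(2) by (intro r_neg nat_pow_closed)
  ultimately show "x \<in> integral_closure R I"
    unfolding integral_closure_def using assms(2) by (auto simp del: nat_pow_Suc intro!: exI[of _ "Suc n"])
qed

end

section \<open>Reductions and integral closure\<close>

text \<open>For an ideal L one inclusion between the two products suffices: the other one follows
  from I \<subseteq> L.\<close>

definition reduction :: "('a, 'b) ring_scheme \<Rightarrow> 'a set \<Rightarrow> 'a set \<Rightarrow> bool"
  where "reduction R I L \<longleftrightarrow>
    I \<subseteq> L \<and> (\<exists>n. ideal_pow R L (Suc n) \<subseteq> I \<cdot>\<^bsub>R\<^esub> ideal_pow R L n)"

context cring
begin

lemma reduction_refl:
  assumes "ideal I R"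
  shows "reduction R I I"
  unfolding reduction_def
  using ideal_prod_commute[OF oneideal assms] by (intro conjI exI[of _ 0]) simp_all

text \<open>Iteration of the defining inclusion: k factors L are exchanged for factors I while L^n
  stays as a fixed remainder. This is how a reduction is applied to high powers.\<close>

lemma reduction_pow_add:
  assumes "ideal I R" "ideal L R" "ideal_pow R L (Suc n) \<subseteq> I \<cdot> ideal_pow R L n"
  shows "ideal_pow R L (k + n) \<subseteq> ideal_pow R I k \<cdot> ideal_pow R L n"
proof (induct k)
  case 0
  then show ?case
    using assms ideal_pow_ideal[OF assms(2), of n] by (simp add: ideal_prod_commute[of "carrier R"] ideal_prod_one oneideal)
next
  case (Suc k)
  note I = ideal_pow_ideal[OF assms(1)] ideal_pow_ideal[OF assms(2)]
  have "ideal_pow R L (Suc k + n) = ideal_pow R L (k + n) \<cdot> L" by simp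
  also have "\<dots> \<subseteq> (ideal_pow R I k \<cdot> ideal_pow R L n) \<cdot> L"
    using Suc by (intro ideal_prod_mono order_refl)
  also have "\<dots> = ideal_pow R I k \<cdot> ideal_pow R L (Suc n)"
    using I assms by (simp add: ideal_prod_assoc)
  also have "\<dots> \<subseteq> ideal_pow R I k \<cdot> (I \<cdot> ideal_pow R L n)"
    using assms by (intro ideal_prod_mono order_refl)
  also have "\<dots> = ideal_pow R I (Suc k) \<cdot> ideal_pow R L n"
    using I assms by (simp add: ideal_prod_assoc)
  finally show ?case .
qed

text \<open>The exponents add up: L^(m+1+n) \<subseteq> K^(m+1) L^n \<subseteq> I K^m L^n
  \<subseteq> I L^(m+n).\<close>

lemma reduction_trans:
  assumes "ideal I R" "ideal K R" "ideal L R" "reduction R I K" "reduction R K L"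
  shows "reduction R I L"
proof -
  obtain m n where m: "ideal_pow R K (Suc m) \<subseteq> I \<cdot> ideal_pow R K m"
    and n: "ideal_pow R L (Suc n) \<subseteq> K \<cdot> ideal_pow R L n" and sub: "I \<subseteq> K" "K \<subseteq> L"
    using assms unfolding reduction_def by auto
  have "ideal_pow R L (Suc m + n) \<subseteq> ideal_pow R K (Suc m) \<cdot> ideal_pow R L n"
    using n assms by (intro reduction_pow_add)
  also have "\<dots> \<subseteq> (I \<cdot> ideal_pow R K m) \<cdot> ideal_pow R L n"
    using m by (intro ideal_prod_mono order_refl)
  also have "\<dots> = I \<cdot> (ideal_pow R K m \<cdot> ideal_pow R L n)"
    using assms by (intro ideal_prod_assoc ideal_intros)
  also have "\<dots> \<subseteq> I \<cdot> (ideal_pow R L m \<cdot> ideal_pow R L n)"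
    using sub by (intro ideal_prod_mono ideal_pow_mono order_refl)
  also have "\<dots> = I \<cdot> ideal_pow R L (m + n)"
    using assms by (simp add: ideal_pow_add)
  finally show ?thesis
    using sub unfolding reduction_def by (intro conjI exI[of _ "m + n"]) auto
qed

lemma ideal_pow_cgenideal_subset:
  assumes x: "x \<in> carrier R"
  shows "ideal_pow R (PIdl x) k \<subseteq> PIdl (x [^] (k::nat))"
proof (induct k)
  case 0
  have "PIdl \<one> = carrier R"
    using cgenideal_ideal cgenideal_self ideal.one_imp_carrier one_closed by blast
  then show ?case by simp
next
  case (Suc k)
  have "ideal_pow R (PIdl x) k \<cdot> (PIdl x) \<subseteq> (PIdl (x [^] k)) \<cdot> (PIdl x)"
    using Suc by (intro ideal_prod_mono order_refl)
  also have "\<dots> \<subseteq> PIdl (x [^] Suc k)"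
  proof (rule ideal_prod_subsetI)
    fix a b assume "a \<in> PIdl (x [^] k)" "b \<in> PIdl x"
    then obtain r s where "a = r \<otimes> x [^] k" "b = s \<otimes> x" "r \<in> carrier R" "s \<in> carrier R"
      by (auto simp: cgenideal_def)
    then show "a \<otimes> b \<in> PIdl (x [^] Suc k)"
      using x by (auto simp: cgenideal_def m_ac intro!: exI[of _ "r \<otimes> s"])
  qed (use x in \<open>auto intro!: cgenideal_ideal\<close>)
  finally show ?case by simp
qed

text \<open>In L^(n+1) \<subseteq> L^n I + (x)^(n+1) the last summand is generated by x^(n+1), and
  integrality says exactly that x^(n+1) lies in I L^n for some n.\<close>

lemma reduction_adjoin:
  assumes "ideal I R" "x \<in> integral_closure R I"
  shows "reduction R I (I <+> PIdl x)"
proof -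
  let ?L = "I <+> PIdl x"
  have x: "x \<in> carrier R" using assms(2) unfolding integral_closure_def by simp
  have X: "ideal (PIdl x) R" using x by (intro ideal_intros)
  have L: "ideal ?L R" using assms(1) X by (rule add_ideals)
  note P = ideal_pow_ideal[OF L]
  obtain n where n: "x [^] Suc n \<in> I \<cdot> ideal_pow R ?L n"
    using assms x by (auto simp only: integral_closure_iff)
  have C: "ideal (I \<cdot> ideal_pow R ?L n) R" using assms(1) P by (rule ideal_prod_is_ideal)
  have "ideal_pow R ?L (Suc n) \<subseteq> ideal_pow R ?L n \<cdot> I <+> ideal_pow R (PIdl x) (Suc n)"
    using assms(1) X by (rule ideal_pow_add_Suc_subset)
  also have "\<dots> \<subseteq> I \<cdot> ideal_pow R ?L n"
  proof -
    have "ideal_pow R (PIdl x) (Suc n) \<subseteq> I \<cdot> ideal_pow R ?L n"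
      using ideal_pow_cgenideal_subset[OF x, of "Suc n"] cgenideal_minimal[OF C n] by (rule subset_trans)
    moreover have "ideal_pow R ?L n \<cdot> I = I \<cdot> ideal_pow R ?L n"
      using P assms by (intro ideal_prod_commute)
    ultimately show ?thesis
      using C ideal_pow_ideal[OF X, of "Suc n"] by (subst set_add_subset_iff) simp_all
  qed
  finally show ?thesis
    using subset_set_add[OF assms(1) X] unfolding reduction_def by blast
qed

lemma integral_closure_subset_carrier: "integral_closure R I \<subseteq> carrier R"
  unfolding integral_closure_def by auto

lemma integral_closure_mono:
  assumes "I \<subseteq> J"
  shows "integral_closure R I \<subseteq> integral_closure R J"
  unfolding integral_closure_def using ideal_pow_mono[OF assms] by blast

lemma subset_integral_closure:
  assumes "ideal I R"
  shows "I \<subseteq> integral_closure R I"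
proof
  fix x assume x: "x \<in> I"
  then have xc: "x \<in> carrier R" using assms ideal.Icarr by metis
  have "x [^] Suc 0 \<in> I \<cdot> ideal_pow R (I <+> PIdl x) 0"
    using x xc assms by (simp add: ideal_prod_one)
  then show "x \<in> integral_closure R I"
    using assms xc integral_closure_iff by blast
qed

section \<open>The determinant trick and roots of integral elements\<close>

text \<open>The annihilator of \<open>u\<close> is an ideal, obtained here as the preimage of the
  zero ideal under multiplication by \<open>u\<close>.\<close>

lemma annihilates_Idl:
  assumes "u \<in> carrier R" "F \<subseteq> carrier R" "\<And>y. y \<in> F \<Longrightarrow> u \<otimes> y = \<zero>" "y \<in> Idl F"
  shows "u \<otimes> y = \<zero>"
proof -
  have "ideal {y \<in> carrier R. u \<otimes> y \<in> {\<zero>}} R"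
    using ideal.helper_max_prime[OF zeroideal is_cring assms(1)] .
  then have "Idl F \<subseteq> {y \<in> carrier R. u \<otimes> y \<in> {\<zero>}}"
    using assms by (intro genideal_minimal) auto
  then show ?thesis using assms(4) by auto
qed

text \<open>The Cayley--Hamilton theorem with coefficients graded by powers of \<open>I\<close>, by eliminating
  the generators one at a time: a generator \<open>m\<close> with \<open>(x [^] (d + 1) - g) m \<in> (F)\<close> is removed
  at the cost of replacing \<open>d + 1\<close> by \<open>2 (d + 1)\<close>.\<close>

lemma monic_annihilator_of_generators:
  assumes I: "ideal I R" and x: "x \<in> carrier R" and "finite F" "F \<subseteq> carrier R"
    and "\<And>y. y \<in> Idl F \<Longrightarrow> x [^] Suc d \<otimes> y \<in> (I \<cdot> ideal_pow R (I <+> PIdl x) d) \<cdot> (Idl F)"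
  shows "\<exists>n. \<exists>g \<in> I \<cdot> ideal_pow R (I <+> PIdl x) n. \<forall>y\<in>F. (x [^] Suc n \<ominus> g) \<otimes> y = \<zero>"
proof -
  let ?L = "I <+> PIdl x"
  \<comment> \<open>\<open>?G n\<close> plays the role of the lower terms of a monic polynomial in x
    of degree n + 1: its elements have the same weight as x^(n+1), with at least one factor from
    \<open>I\<close>. \<open>Gprod\<close> says that the weights add.\<close>
  let ?G = "\<lambda>n. I \<cdot> ideal_pow R ?L n"
  have X: "ideal (PIdl x) R" using x by (intro ideal_intros)
  have L: "ideal ?L R" using I X by (intro add_ideals)
  have xL: "x \<in> ?L" using subset_set_add(2)[OF I X] cgenideal_self[OF x] by auto
  have P: "ideal (ideal_pow R ?L n) R" for n :: nat using L by (rule ideal_pow_ideal)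
  have G: "ideal (?G n) R" for n :: nat using I P by (rule ideal_prod_is_ideal)
  have Gc: "a \<in> carrier R" if "a \<in> ?G n" for a and n :: nat
    using that G ideal.Icarr by metis
  have Gadd: "a \<oplus> b \<in> ?G n" "a \<ominus> b \<in> ?G n" if "a \<in> ?G n" "b \<in> ?G n" for a b and n :: nat
    using that G[of n] by (auto simp: a_minus_def additive_subgroup.a_closed additive_subgroup.a_inv_closed ideal.axioms(1))
  have Gprod: "a \<otimes> b \<in> ?G (Suc (m + n))" if a: "a \<in> ideal_pow R ?L (Suc m)" and b: "b \<in> ?G n" for a b m n
  proof -
    have "a \<otimes> b \<in> ideal_pow R ?L (Suc m) \<cdot> ?G n"
      using a b by (intro ideal_prod.prod)
    also have "\<dots> = I \<cdot> (ideal_pow R ?L (Suc m) \<cdot> ideal_pow R ?L n)"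
      using I P by (intro ideal_prod_left_commute)
    also have "\<dots> = ?G (Suc (m + n))"
      using L by (simp only: ideal_pow_add[symmetric]) simp
    finally show ?thesis .
  qed
  have xpow: "x [^] Suc n \<in> ideal_pow R ?L (Suc n)" for n :: nat
    using nat_pow_mem_ideal_pow[OF xL] .
  have GL: "a \<in> ideal_pow R ?L (Suc n)" if "a \<in> ?G n" for a and n :: nat
  proof -
    have "?G n \<subseteq> ?L \<cdot> ideal_pow R ?L n"
      using subset_set_add(1)[OF I X] by (intro ideal_prod_mono) auto
    then show ?thesis using that L P by (auto simp: ideal_prod_commute)
  qed
  show ?thesis using assms(3-5)
  proof (induct F arbitrary: d)
    case empty
    have "\<zero> \<in> ?G 0" using G[of 0] by (simp add: additive_subgroup.zero_closed ideal.axioms(1))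
    then show ?case by blast
  next
    case (insert m F)
    have m: "m \<in> carrier R" and Fc: "F \<subseteq> carrier R" using insert.prems by auto
    have F: "ideal (Idl F) R" using Fc by (rule genideal_ideal)
    have ins: "Idl (insert m F) = Idl F <+> PIdl m" using m Fc by (rule Idl_insert)
    have ideals: "ideal (PIdl m) R" using m by (rule cgenideal_ideal)
    have step: "\<exists>f h. f \<in> ?G d \<cdot> (Idl F) \<and> h \<in> ?G d \<and> x [^] Suc d \<otimes> y = f \<oplus> h \<otimes> m"
      if y: "y \<in> Idl (insert m F)" for y
    proof -
      have "x [^] Suc d \<otimes> y \<in> ?G d \<cdot> (Idl F <+> PIdl m)"
        using insert.prems(2)[OF y] ins by simp
      also have "\<dots> = ?G d \<cdot> (Idl F) <+> ?G d \<cdot> (PIdl m)"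
        using G F ideals by (intro ideal_prod_distr)
      finally obtain f u where f: "f \<in> ?G d \<cdot> (Idl F)" and u: "u \<in> ?G d \<cdot> (PIdl m)"
        and "x [^] Suc d \<otimes> y = f \<oplus> u"
        by (rule mem_set_addE)
      with mem_ideal_prod_cgenideal[OF G m u] show ?thesis by metis
    qed
    have sub: "F \<subseteq> Idl F" "insert m F \<subseteq> Idl (insert m F)"
      using genideal_self[OF Fc] genideal_self[of "insert m F"] Fc m by auto
    have Fsub: "Idl F \<subseteq> Idl (insert m F)"
      using subset_set_add(1)[OF F ideals] ins by simp
    have GF: "ideal (?G n \<cdot> (Idl F)) R" for n :: nat using G F by (rule ideal_prod_is_ideal)
    have GFc: "f \<in> carrier R" if "f \<in> ?G n \<cdot> (Idl F)" for f and n :: nat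
      using that GF ideal.Icarr by metis
    obtain f0 g where f0: "f0 \<in> ?G d \<cdot> (Idl F)" and g: "g \<in> ?G d" and eqm: "x [^] Suc d \<otimes> m = f0 \<oplus> g \<otimes> m"
      using step[of m] sub by auto
    have gc: "g \<in> carrier R" and f0c: "f0 \<in> carrier R" using g f0 Gc GFc by auto
    let ?X = "x [^] Suc d"
    have Xc: "?X \<in> carrier R" using x by (rule nat_pow_closed)
    \<comment> \<open>The factor \<open>?X \<ominus> g\<close> moves the generator \<open>m\<close>
      into (F), which allows \<open>m\<close> to be eliminated.\<close>
    have um: "(?X \<ominus> g) \<otimes> m = f0"
    proof -
      have "(?X \<ominus> g) \<otimes> m = ?X \<otimes> m \<ominus> g \<otimes> m"
        using Xc gc m by (simp add: a_minus_def l_distr l_minus del: nat_pow_Suc)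
      also have "\<dots> = f0"
        unfolding eqm using f0c gc m by (simp add: a_minus_def a_assoc r_neg)
      finally show ?thesis .
    qed
    have shift: "a \<otimes> f \<in> ?G (Suc (d + d)) \<cdot> (Idl F)"
      if a: "a \<in> ideal_pow R ?L (Suc d)" and f: "f \<in> ?G d \<cdot> (Idl F)" for a f
    proof -
      have "a \<otimes> f \<in> ideal_pow R ?L (Suc d) \<cdot> (?G d \<cdot> (Idl F))"
        using a f by (intro ideal_prod.prod)
      also have "\<dots> = (ideal_pow R ?L (Suc d) \<cdot> ?G d) \<cdot> (Idl F)"
        using P[of "Suc d"] G F by (subst ideal_prod_assoc) auto
      also have "\<dots> \<subseteq> ?G (Suc (d + d)) \<cdot> (Idl F)"
        by (intro ideal_prod_mono order_refl ideal_prod_subsetI G Gprod)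
      finally show ?thesis .
    qed
    have main: "x [^] Suc (Suc (d + d)) \<otimes> y \<in> ?G (Suc (d + d)) \<cdot> (Idl F)" if y: "y \<in> Idl F" for y
    proof -
      obtain f h where f: "f \<in> ?G d \<cdot> (Idl F)" and h: "h \<in> ?G d" and eq: "?X \<otimes> y = f \<oplus> h \<otimes> m"
        using step[of y] y Fsub by auto
      have c: "y \<in> carrier R" "f \<in> carrier R" "h \<in> carrier R"
        using y f h Gc GFc ideal.Icarr[OF F] by auto
      \<comment> \<open>The relation for y is multiplied by \<open>?X \<ominus> g\<close>, which
        turns its term h m into h \<open>f0\<close>. Adding g \<open>?X\<close> y back leaves
        \<open>?X\<close>^2 y on the left and only terms from (F), with coefficients of weight 2 (d
        + 1), on the right.\<close>
      have "(?X \<ominus> g) \<otimes> (?X \<otimes> y) = (?X \<ominus> g) \<otimes> f \<oplus> h \<otimes> ((?X \<ominus> g) \<otimes> m)"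
        unfolding eq using c Xc gc m by (simp add: l_distr r_distr m_ac del: nat_pow_Suc)
      also have "\<dots> = (?X \<ominus> g) \<otimes> f \<oplus> h \<otimes> f0" by (simp only: um)
      finally have e: "(?X \<ominus> g) \<otimes> (?X \<otimes> y) = (?X \<ominus> g) \<otimes> f \<oplus> h \<otimes> f0" .
      have "?X \<otimes> (?X \<otimes> y) = (?X \<ominus> g) \<otimes> (?X \<otimes> y) \<oplus> (g \<otimes> ?X) \<otimes> y"
      proof -
        have "?X = (?X \<ominus> g) \<oplus> g" using Xc gc by (simp add: a_minus_def a_assoc l_neg del: nat_pow_Suc)
        then have "?X \<otimes> (?X \<otimes> y) = ((?X \<ominus> g) \<oplus> g) \<otimes> (?X \<otimes> y)" by simp
        then show ?thesis using Xc gc c by (simp add: l_distr m_assoc del: nat_pow_Suc)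
      qed
      moreover have "?X \<otimes> ?X = x [^] Suc (Suc (d + d))"
        using x nat_pow_mult[OF x, of "Suc d" "Suc d"] by simp
      ultimately have "x [^] Suc (Suc (d + d)) \<otimes> y = (?X \<ominus> g) \<otimes> f \<oplus> h \<otimes> f0 \<oplus> (g \<otimes> ?X) \<otimes> y"
        using e Xc c m_assoc by metis
      moreover have "?X \<ominus> g \<in> ideal_pow R ?L (Suc d)"
        using xpow[of d] GL[OF g] P[of "Suc d"]
        by (simp only: a_minus_def additive_subgroup.a_closed additive_subgroup.a_inv_closed ideal.axioms(1))
      moreover have "(g \<otimes> ?X) \<otimes> y \<in> ?G (Suc (d + d)) \<cdot> (Idl F)"
        using ideal_prod.prod[OF Gprod[OF xpow[of d] g] y] m_comm[OF Xc gc] by simp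
      ultimately show ?thesis
        using shift[OF _ f] shift[OF GL[OF h] f0] by (auto intro!: ideal_prod.sum simp del: nat_pow_Suc)
    qed
    obtain n g' where g': "g' \<in> ?G n" and kill: "\<And>y. y \<in> F \<Longrightarrow> (x [^] Suc n \<ominus> g') \<otimes> y = \<zero>"
      using insert.hyps(3)[OF Fc main] by blast
    let ?Y = "x [^] Suc n"
    have Yc: "?Y \<in> carrier R" and gc': "g' \<in> carrier R" using x g' Gc by (auto simp del: nat_pow_Suc)
    have killF: "(?Y \<ominus> g') \<otimes> y = \<zero>" if "y \<in> Idl F" for y
      using annihilates_Idl[OF _ Fc kill that] Yc gc' by simp
    have f0F: "f0 \<in> Idl F" using f0 ideal_prod_subset(2)[OF G F] by auto
    \<comment> \<open>The lower part of the product of \<open>?Y \<ominus> g'\<close> and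
      \<open>?X \<ominus> g\<close>, up to sign. The second factor sends \<open>m\<close> into (F)
      and the first kills (F), so the product kills all generators; its degree is the sum of the two
      degrees.\<close>
    define k where "k = ?Y \<otimes> g \<oplus> ?X \<otimes> g' \<ominus> g' \<otimes> g"
    have "k \<in> ?G (Suc (n + d))"
    proof -
      have "?Y \<otimes> g \<in> ?G (Suc (n + d))" "g' \<otimes> g \<in> ?G (Suc (n + d))" "?X \<otimes> g' \<in> ?G (Suc (n + d))"
        using Gprod[OF xpow[of n] g] Gprod[OF GL[OF g'] g] Gprod[OF xpow g', of d] by (simp_all add: add.commute del: nat_pow_Suc)
      then show ?thesis unfolding k_def by (intro Gadd)
    qed
    moreover have "x [^] Suc (Suc (n + d)) \<ominus> k = (?Y \<ominus> g') \<otimes> (?X \<ominus> g)"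
    proof -
      have "x [^] Suc (Suc (n + d)) = ?Y \<otimes> ?X"
        using x nat_pow_mult[OF x, of "Suc n" "Suc d"] by simp
      moreover have "?Y \<otimes> ?X \<ominus> k = (?Y \<ominus> g') \<otimes> (?X \<ominus> g)"
        unfolding k_def using Yc Xc gc gc'
        by (simp add: a_minus_def l_distr r_distr l_minus r_minus minus_add minus_minus a_ac m_ac del: nat_pow_Suc)
      ultimately show ?thesis by simp
    qed
    moreover have "(?Y \<ominus> g') \<otimes> (?X \<ominus> g) \<otimes> y = \<zero>" if "y \<in> insert m F" for y
    proof (cases "y = m")
      case True
      then show ?thesis
        using um killF[OF f0F] Xc Yc gc gc' m by (simp add: m_assoc del: nat_pow_Suc)
    next
      case False
      with that have "y \<in> F" by simp
      moreover from this have "y \<in> carrier R" using Fc by auto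
      ultimately show ?thesis
        using kill[of y] Xc Yc gc gc' m_lcomm[of "?Y \<ominus> g'" "?X \<ominus> g" y] by (simp add: m_assoc del: nat_pow_Suc)
    qed
    ultimately show ?case by (intro exI[of _ "Suc (n + d)"] bexI[of _ k]) simp_all
  qed
qed

text \<open>With L = I + (x) one has I^n \<subseteq> I L^(n-1) and I^n + (x^n) \<subseteq> L^n.
  Hence the membership that expresses integrality of x^n over I^n turns into x^(n(m+1)) \<in> I
  L^(n(m+1)-1), which is the one for x over I.\<close>

lemma integral_closure_of_pow:
  assumes "ideal I R" "x \<in> carrier R" "n \<ge> (1::nat)"
    and "x [^] n \<in> integral_closure R (ideal_pow R I n)"
  shows "x \<in> integral_closure R I"
proof -
  let ?L = "I <+> PIdl x"
  have X: "ideal (PIdl x) R" using assms by (intro cgenideal_ideal)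
  have L: "ideal ?L R" using assms(1) X by (rule add_ideals)
  have sub: "I \<subseteq> ?L" "x \<in> ?L"
    using subset_set_add[OF assms(1) X] cgenideal_self[OF assms(2)] by auto
  obtain k where k: "n = Suc k" using assms(3) by (cases n) auto
  have In: "ideal (ideal_pow R I n) R" using assms(1) by (rule ideal_pow_ideal)
  obtain m where m: "(x [^] n) [^] Suc m \<in> ideal_pow R I n \<cdot> ideal_pow R (ideal_pow R I n <+> PIdl (x [^] n)) m"
    using assms In integral_closure_iff[OF In] by blast
  have "ideal_pow R I n \<subseteq> I \<cdot> ideal_pow R ?L k"
    unfolding k using assms(1) ideal_pow_mono[OF sub(1), of k] ideal_pow_ideal[OF assms(1), of k]
    by (simp add: ideal_prod_commute[of _ I] ideal_prod_mono)
  moreover have "ideal_pow R I n <+> PIdl (x [^] n) \<subseteq> ideal_pow R ?L n"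
    using In ideal_pow_ideal[OF L, of n] ideal_pow_mono[OF sub(1), of n] nat_pow_mem_ideal_pow[OF sub(2), of n] assms(2)
    by (subst set_add_subset_iff) (simp_all add: cgenideal_subset_iff cgenideal_ideal)
  ultimately have "ideal_pow R I n \<cdot> ideal_pow R (ideal_pow R I n <+> PIdl (x [^] n)) m
      \<subseteq> (I \<cdot> ideal_pow R ?L k) \<cdot> ideal_pow R (ideal_pow R ?L n) m"
    by (intro ideal_prod_mono ideal_pow_mono)
  also have "\<dots> = I \<cdot> ideal_pow R ?L (k + n * m)"
    using assms(1) L by (simp add: ideal_pow_add ideal_pow_mult ideal_prod_assoc ideal_pow_ideal)
  finally have "x [^] Suc (k + n * m) \<in> I \<cdot> ideal_pow R ?L (k + n * m)"
    using m k nat_pow_pow[OF assms(2), of n "Suc m"] by (auto simp: algebra_simps simp del: nat_pow_Suc)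
  then show ?thesis
    using integral_closure_iff[OF assms(1,2)] by blast
qed

end

section \<open>Integral closure and reductions in Noetherian rings\<close>

locale noetherian_cring = cring + noetherian_ring

context noetherian_cring
begin

text \<open>The determinant trick, with z^n \<in> W in place of faithfulness of \<open>W\<close>.
  The element z^(k+1) - g kills the generators of \<open>W\<close>, hence also z^n, and z^(k+1+n) =
  g z^n lies in I K^(k+n) for K = I + (z).\<close>

lemma mem_integral_closure_of_module:
  assumes "ideal I R" "z \<in> carrier R" "ideal W R"
    and "\<And>y. y \<in> W \<Longrightarrow> z \<otimes> y \<in> I \<cdot> W" and "z [^] (n::nat) \<in> W"
  shows "z \<in> integral_closure R I"
proof -
  note z = assms(2)
  let ?K = "I <+> PIdl z"
  have Z: "ideal (PIdl z) R" using z by (rule cgenideal_ideal)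
  have K: "ideal ?K R" using assms(1) Z by (rule add_ideals)
  have zK: "z \<in> ?K" using subset_set_add(2)[OF assms(1) Z] cgenideal_self[OF z] by auto
  obtain F where F: "F \<subseteq> carrier R" "finite F" "W = Idl F"
    using finetely_gen[OF assms(3)] by blast
  have "z [^] Suc 0 \<otimes> y \<in> (I \<cdot> ideal_pow R ?K 0) \<cdot> (Idl F)" if "y \<in> Idl F" for y
    using assms(1,4) that z by (simp add: ideal_prod_one F(3))
  from monic_annihilator_of_generators[OF assms(1) z F(2,1) this]
  obtain k g where g: "g \<in> I \<cdot> ideal_pow R ?K k" and kill: "\<And>y. y \<in> F \<Longrightarrow> (z [^] Suc k \<ominus> g) \<otimes> y = \<zero>"
    by blast
  have G: "ideal (I \<cdot> ideal_pow R ?K k) R"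
    using assms(1) ideal_pow_ideal[OF K] by (rule ideal_prod_is_ideal)
  have gc: "g \<in> carrier R" using g G ideal.Icarr by metis
  have "(z [^] Suc k \<ominus> g) \<otimes> z [^] n = \<zero>"
    using annihilates_Idl[OF _ F(1) kill] assms(5) F(3) z gc by (metis minus_closed nat_pow_closed)
  then have "z [^] Suc k \<otimes> z [^] n \<ominus> g \<otimes> z [^] n = \<zero>"
    using z gc by (simp add: a_minus_def l_distr l_minus del: nat_pow_Suc)
  then have "z [^] Suc k \<otimes> z [^] n = g \<otimes> z [^] n"
    using z gc by (simp del: nat_pow_Suc)
  then have "z [^] Suc (k + n) = g \<otimes> z [^] n"
    using nat_pow_mult[OF z, of "Suc k" n] by simp
  also have "\<dots> \<in> (I \<cdot> ideal_pow R ?K k) \<cdot> ideal_pow R ?K n"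
    using g nat_pow_mem_ideal_pow[OF zK, of n] by (rule ideal_prod.prod)
  also have "\<dots> = I \<cdot> ideal_pow R ?K (k + n)"
    using assms(1) K by (simp add: ideal_pow_add ideal_prod_assoc ideal_pow_ideal)
  finally show ?thesis
    using integral_closure_iff[OF assms(1) z] by blast
qed

text \<open>The module for the determinant trick is L^n: it contains z^n, and multiplication by z
  sends it into L^(n+1) \<subseteq> I L^n.\<close>

lemma reduction_imp_subset_integral_closure:
  assumes "ideal I R" "ideal L R" "reduction R I L"
  shows "L \<subseteq> integral_closure R I"
proof
  fix z assume zL: "z \<in> L"
  then have z: "z \<in> carrier R" using assms(2) ideal.Icarr by metis
  obtain n where n: "ideal_pow R L (Suc n) \<subseteq> I \<cdot> ideal_pow R L n"
    using assms(3) unfolding reduction_def by auto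
  have L: "ideal (ideal_pow R L n) R" using assms(2) by (rule ideal_pow_ideal)
  show "z \<in> integral_closure R I"
  proof (rule mem_integral_closure_of_module[OF assms(1) z L])
    show "z [^] n \<in> ideal_pow R L n" using zL by (rule nat_pow_mem_ideal_pow)
    fix y assume y: "y \<in> ideal_pow R L n"
    then have "y \<otimes> z \<in> ideal_pow R L (Suc n)"
      using zL by (simp add: ideal_prod.prod)
    then show "z \<otimes> y \<in> I \<cdot> ideal_pow R L n"
      using n z y ideal.Icarr[OF L] m_comm by auto
  qed
qed

text \<open>For the converse a finite generating set of \<open>L\<close> is adjoined to
  \<open>I\<close> one element at a time. Each stage is a reduction of the next, and transitivity
  composes them.\<close>

lemma reduction_iff_subset_integral_closure:
  assumes "ideal I R" "ideal L R" "I \<subseteq> L"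
  shows "reduction R I L \<longleftrightarrow> L \<subseteq> integral_closure R I"
proof
  assume sub: "L \<subseteq> integral_closure R I"
  have "reduction R I (I <+> Idl F)" if "finite F" "F \<subseteq> L" for F
    using that
  proof (induct F)
    case empty
    have "Idl {} \<subseteq> {\<zero>}" by (intro genideal_minimal zeroideal) simp
    then have "I <+> Idl {} = I"
      using assms(1) subset_set_add(1)[OF assms(1), of "Idl {}"] genideal_ideal[of "{}"]
      by (intro equalityI) (auto simp: set_add_subset_iff additive_subgroup.zero_closed ideal.axioms(1))
    then show ?case using reduction_refl[OF assms(1)] by simp
  next
    case (insert x F)
    have F: "F \<subseteq> carrier R" and x: "x \<in> carrier R"
      using insert.prems assms(2) by (auto intro: ideal.Icarr)
    note ids = genideal_ideal[OF F] cgenideal_ideal[OF x]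
    have IF: "ideal (I <+> Idl F) R" using assms(1) ids by (intro add_ideals)
    have "x \<in> integral_closure R (I <+> Idl F)"
      using insert.prems sub integral_closure_mono[OF subset_set_add(1)[OF assms(1) ids(1)]] by auto
    then have "reduction R (I <+> Idl F) (I <+> Idl F <+> PIdl x)"
      by (rule reduction_adjoin[OF IF])
    moreover have "I <+> Idl F <+> PIdl x = I <+> Idl (insert x F)"
      unfolding Idl_insert[OF x F] using assms(1) ids
      by (simp add: add.set_mult_assoc set_add_defs(1) additive_subgroup.a_subset ideal.axioms(1))
    ultimately show ?case
      using reduction_trans[OF assms(1) IF add_ideals[OF IF ids(2)] insert.hyps(3)] insert.prems by simp
  qed
  moreover obtain F where F: "F \<subseteq> carrier R" "finite F" "L = Idl F"
    using finetely_gen[OF assms(2)] by blast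
  moreover have "I <+> L = L"
    using assms subset_set_add(2)[OF assms(1,2)] by (intro equalityI) (simp_all add: set_add_subset_iff)
  ultimately show "reduction R I L"
    using genideal_self by metis
qed (use reduction_imp_subset_integral_closure assms in blast)

text \<open>Two integral elements x and y lie in the ideal I + (x) + (y), which has \<open>I\<close>
  as a reduction and therefore consists of integral elements. All closure properties are read off
  from such ideals.\<close>

lemma integral_closure_ideal:
  assumes I: "ideal I R"
  shows "ideal (integral_closure R I) R"
proof -
  have ex: "\<exists>L. ideal L R \<and> x \<in> L \<and> y \<in> L \<and> L \<subseteq> integral_closure R I"
    if x: "x \<in> integral_closure R I" and y: "y \<in> integral_closure R I" for x y
  proof -
    have c: "x \<in> carrier R" "y \<in> carrier R" using x y integral_closure_subset_carrier by auto
    note ids = cgenideal_ideal[OF c(1)] cgenideal_ideal[OF c(2)]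
    let ?A = "I <+> PIdl x" and ?B = "I <+> PIdl x <+> PIdl y"
    have A: "ideal ?A R" using I ids by (intro add_ideals)
    have B: "ideal ?B R" using A ids(2) by (rule add_ideals)
    have "y \<in> integral_closure R ?A"
      using y integral_closure_mono[OF subset_set_add(1)[OF I ids(1)]] by auto
    then have "reduction R I ?B"
      using reduction_trans[OF I A B reduction_adjoin[OF I x] reduction_adjoin[OF A]] by simp
    then have "?B \<subseteq> integral_closure R I"
      using reduction_imp_subset_integral_closure[OF I B] by simp
    moreover have "x \<in> ?B" "y \<in> ?B"
      using subset_set_add[OF A ids(2)] subset_set_add(2)[OF I ids(1)] cgenideal_self[OF c(1)] cgenideal_self[OF c(2)]
      by auto
    ultimately show ?thesis using B by blast
  qed
  show ?thesis
  proof (rule idealI[OF ring_axioms])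
    show "subgroup (integral_closure R I) (add_monoid R)"
    proof (rule add.subgroupI)
      show "integral_closure R I \<subseteq> carrier R" by (rule integral_closure_subset_carrier)
      show "integral_closure R I \<noteq> {}"
        using subset_integral_closure[OF I] additive_subgroup.zero_closed[OF ideal.axioms(1)[OF I]] by auto
    next
      fix a assume "a \<in> integral_closure R I"
      then show "\<ominus> a \<in> integral_closure R I"
        using ex[of a a] by (auto dest: additive_subgroup.a_inv_closed[OF ideal.axioms(1)])
    next
      fix a b assume "a \<in> integral_closure R I" "b \<in> integral_closure R I"
      then show "a \<oplus> b \<in> integral_closure R I"
        using ex[of a b] by (auto dest: additive_subgroup.a_closed[OF ideal.axioms(1)])
    qed
  next
    fix a r assume "a \<in> integral_closure R I" "r \<in> carrier R"
    then show "r \<otimes> a \<in> integral_closure R I" "a \<otimes> r \<in> integral_closure R I"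
      using ex[of a a] by (auto dest: ideal.I_l_closed ideal.I_r_closed)
  qed
qed

lemma reduction_integral_closure:
  assumes "ideal I R"
  shows "reduction R I (integral_closure R I)"
  using reduction_iff_subset_integral_closure[OF assms integral_closure_ideal[OF assms]]
    subset_integral_closure[OF assms] by simp

lemma integral_closure_idem:
  assumes "ideal I R"
  shows "integral_closure R (integral_closure R I) = integral_closure R I"
proof -
  note C = integral_closure_ideal[OF assms]
  note C' = integral_closure_ideal[OF C]
  have "reduction R I (integral_closure R (integral_closure R I))"
    using reduction_trans[OF assms C C' reduction_integral_closure[OF assms] reduction_integral_closure[OF C]] .
  then show ?thesis
    using reduction_imp_subset_integral_closure[OF assms C'] subset_integral_closure[OF C] by auto
qed

lemma integral_closure_least:
  assumes "ideal J R" "I \<subseteq> integral_closure R J"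
  shows "integral_closure R I \<subseteq> integral_closure R J"
  using integral_closure_mono[OF assms(2)] integral_closure_idem[OF assms(1)] by simp

text \<open>Reduction inclusions with the same exponent can be multiplied, since (K L)^j = K^j L^j;
  both are therefore raised to the exponent m + n first.\<close>

lemma integral_closure_prod:
  assumes I: "ideal I R" and J: "ideal J R"
  shows "integral_closure R I \<cdot> integral_closure R J \<subseteq> integral_closure R (I \<cdot> J)"
proof -
  let ?K = "integral_closure R I" and ?L = "integral_closure R J"
  note K = integral_closure_ideal[OF I] and L = integral_closure_ideal[OF J]
  note P = ideal_pow_ideal[OF K] ideal_pow_ideal[OF L]
  obtain m n where m: "ideal_pow R ?K (Suc m) \<subseteq> I \<cdot> ideal_pow R ?K m"
    and n: "ideal_pow R ?L (Suc n) \<subseteq> J \<cdot> ideal_pow R ?L n"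
    using reduction_integral_closure[OF I] reduction_integral_closure[OF J] unfolding reduction_def by metis
  have m': "ideal_pow R ?K (Suc (m + n)) \<subseteq> I \<cdot> ideal_pow R ?K (m + n)"
  proof -
    have "ideal_pow R ?K (Suc (m + n)) = ideal_pow R ?K (Suc m) \<cdot> ideal_pow R ?K n"
      using ideal_pow_add[OF K, of "Suc m" n] by simp
    also have "\<dots> \<subseteq> (I \<cdot> ideal_pow R ?K m) \<cdot> ideal_pow R ?K n"
      using m by (intro ideal_prod_mono order_refl)
    finally show ?thesis
      using I K P by (simp add: ideal_pow_add ideal_prod_assoc)
  qed
  have n': "ideal_pow R ?L (Suc (m + n)) \<subseteq> J \<cdot> ideal_pow R ?L (m + n)"
  proof -
    have "ideal_pow R ?L (Suc (m + n)) = ideal_pow R ?L (Suc n) \<cdot> ideal_pow R ?L m"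
      using ideal_pow_add[OF L, of "Suc n" m] by (simp add: add.commute)
    also have "\<dots> \<subseteq> (J \<cdot> ideal_pow R ?L n) \<cdot> ideal_pow R ?L m"
      using n by (intro ideal_prod_mono order_refl)
    also have "\<dots> = J \<cdot> ideal_pow R ?L (n + m)"
      using J L P by (simp add: ideal_pow_add ideal_prod_assoc)
    finally show ?thesis by (simp add: add.commute)
  qed
  have "ideal_pow R (?K \<cdot> ?L) (Suc (m + n)) = ideal_pow R ?K (Suc (m + n)) \<cdot> ideal_pow R ?L (Suc (m + n))"
    using K L by (rule ideal_pow_ideal_prod)
  also have "\<dots> \<subseteq> (I \<cdot> ideal_pow R ?K (m + n)) \<cdot> (J \<cdot> ideal_pow R ?L (m + n))"
    using m' n' by (rule ideal_prod_mono)
  also have "\<dots> = (I \<cdot> J) \<cdot> (ideal_pow R ?K (m + n) \<cdot> ideal_pow R ?L (m + n))"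
    using I J P by (simp add: ideal_prod_ac ideal_prod_is_ideal)
  also have "\<dots> = (I \<cdot> J) \<cdot> ideal_pow R (?K \<cdot> ?L) (m + n)"
    using K L by (simp only: ideal_pow_ideal_prod)
  finally have "reduction R (I \<cdot> J) (?K \<cdot> ?L)"
    unfolding reduction_def
    using ideal_prod_mono[OF subset_integral_closure[OF I] subset_integral_closure[OF J]] by blast
  then show ?thesis
    using reduction_imp_subset_integral_closure[OF ideal_prod_is_ideal[OF I J] ideal_prod_is_ideal[OF K L]] by simp
qed

lemma integral_closure_pow:
  assumes "ideal I R"
  shows "ideal_pow R (integral_closure R I) n \<subseteq> integral_closure R (ideal_pow R I (n::nat))"
proof (induct n)
  case 0
  show ?case using subset_integral_closure[OF oneideal] by simp
next
  case (Suc n)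
  have "ideal_pow R (integral_closure R I) (Suc n)
      \<subseteq> integral_closure R (ideal_pow R I n) \<cdot> integral_closure R I"
    using Suc by (simp add: ideal_prod_mono)
  also have "\<dots> \<subseteq> integral_closure R (ideal_pow R I (Suc n))"
    using integral_closure_prod[OF ideal_pow_ideal[OF assms] assms] by simp
  finally show ?case .
qed

end

section \<open>The special part of the integral closure\<close>

context noetherian_cring
begin

text \<open>The ideals that define the special parts of \<open>I\<close> and of its closure have
  equal closures for every exponent, which gives the first equality of (3).\<close>

lemma integral_closure_prod_pow_integral_closure:
  assumes "ideal M R" "ideal I R"
  shows "integral_closure R (M \<cdot> ideal_pow R (integral_closure R I) n)
    = integral_closure R (M \<cdot> ideal_pow R I n)"
proof
  have "M \<cdot> ideal_pow R (integral_closure R I) n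
      \<subseteq> integral_closure R M \<cdot> integral_closure R (ideal_pow R I n)"
    using assms by (intro ideal_prod_mono integral_closure_pow subset_integral_closure)
  also have "\<dots> \<subseteq> integral_closure R (M \<cdot> ideal_pow R I n)"
    using assms by (intro integral_closure_prod ideal_pow_ideal)
  finally show "integral_closure R (M \<cdot> ideal_pow R (integral_closure R I) n)
      \<subseteq> integral_closure R (M \<cdot> ideal_pow R I n)"
    using assms by (intro integral_closure_least ideal_prod_is_ideal ideal_pow_ideal)
  show "integral_closure R (M \<cdot> ideal_pow R I n)
      \<subseteq> integral_closure R (M \<cdot> ideal_pow R (integral_closure R I) n)"
    using assms by (intro integral_closure_mono ideal_prod_mono order_refl ideal_pow_mono subset_integral_closure)
qed

lemma integral_closure_sp_integral_closure:
  assumes "ideal M R" "ideal I R"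
  shows "integral_closure_sp R M (integral_closure R I) = integral_closure_sp R M I"
  unfolding integral_closure_sp_def using assms by (simp only: integral_closure_prod_pow_integral_closure)

text \<open>Raises exponents: extra factors from the closure of \<open>I\<close> increase the power
  of \<open>I\<close> without losing the factor \<open>M\<close>.\<close>

lemma integral_closure_prod_pow_subset:
  assumes "ideal M R" "ideal I R"
  shows "integral_closure R (M \<cdot> ideal_pow R I m) \<cdot> ideal_pow R (integral_closure R I) n
    \<subseteq> integral_closure R (M \<cdot> ideal_pow R I (m + n))"
proof -
  have "integral_closure R (M \<cdot> ideal_pow R I m) \<cdot> ideal_pow R (integral_closure R I) n
      \<subseteq> integral_closure R (M \<cdot> ideal_pow R I m) \<cdot> integral_closure R (ideal_pow R I n)"
    using assms by (intro ideal_prod_mono integral_closure_pow order_refl)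
  also have "\<dots> \<subseteq> integral_closure R ((M \<cdot> ideal_pow R I m) \<cdot> ideal_pow R I n)"
    using assms by (intro integral_closure_prod ideal_prod_is_ideal ideal_pow_ideal)
  also have "(M \<cdot> ideal_pow R I m) \<cdot> ideal_pow R I n = M \<cdot> ideal_pow R I (m + n)"
    using assms by (simp add: ideal_pow_add ideal_prod_assoc ideal_pow_ideal)
  finally show ?thesis .
qed

lemma integral_closure_sp_subset:
  assumes "ideal M R" "ideal I R"
  shows "integral_closure_sp R M I \<subseteq> integral_closure R I"
proof
  fix x assume "x \<in> integral_closure_sp R M I"
  then obtain n where x: "x \<in> carrier R" "n \<ge> (1::nat)" "x [^] n \<in> integral_closure R (M \<cdot> ideal_pow R I n)"
    unfolding integral_closure_sp_def by auto
  have "M \<cdot> ideal_pow R I n \<subseteq> ideal_pow R I n"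
    using assms by (intro ideal_prod_subset ideal_pow_ideal)
  then have "x [^] n \<in> integral_closure R (ideal_pow R I n)"
    using x(3) integral_closure_mono by blast
  then show "x \<in> integral_closure R I"
    using integral_closure_of_pow assms x by blast
qed

lemma prod_subset_integral_closure_sp:
  assumes "ideal M R" "ideal I R"
  shows "M \<cdot> I \<subseteq> integral_closure_sp R M I"
proof
  fix x assume x: "x \<in> M \<cdot> I"
  then have "x \<in> carrier R" using ideal_prod_in_carrier[OF assms] by auto
  moreover have "x \<in> integral_closure R (M \<cdot> I)"
    using x subset_integral_closure[OF ideal_prod_is_ideal[OF assms]] by auto
  ultimately show "x \<in> integral_closure_sp R M I"
    unfolding integral_closure_sp_def using ideal_pow_1[OF assms(2)] by (auto intro!: exI[of _ "1::nat"] simp del: nat_pow_Suc)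
qed

text \<open>An ideal-wise version of \<open>integral_closure_sp\<close>, with one exponent for all the elements of \<open>A\<close>.\<close>

definition special :: "'a set \<Rightarrow> 'a set \<Rightarrow> 'a set \<Rightarrow> bool"
  where "special M I A \<longleftrightarrow> A \<subseteq> integral_closure R I \<and>
    (\<exists>n. ideal_pow R A (Suc n) \<subseteq> integral_closure R (M \<cdot> ideal_pow R I (Suc n)))"

lemma special_subset_integral_closure_sp:
  assumes "special M I A"
  shows "A \<subseteq> integral_closure_sp R M I"
proof
  fix x assume x: "x \<in> A"
  then have "x \<in> carrier R"
    using assms integral_closure_subset_carrier unfolding special_def by auto
  moreover obtain n where "ideal_pow R A (Suc n) \<subseteq> integral_closure R (M \<cdot> ideal_pow R I (Suc n))"
    using assms unfolding special_def by auto
  moreover have "x [^] Suc n \<in> ideal_pow R A (Suc n)"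
    using x by (rule nat_pow_mem_ideal_pow)
  moreover have "Suc n \<ge> 1" by simp
  ultimately show "x \<in> integral_closure_sp R M I"
    unfolding integral_closure_sp_def by blast
qed

text \<open>For a principal ideal the exponent of its generator serves the whole ideal, since (x)^n
  is contained in (x^n).\<close>

lemma special_cgenideal:
  assumes "ideal M R" "ideal I R" "x \<in> integral_closure_sp R M I"
  shows "special M I (PIdl x)"
proof -
  obtain n where x: "x \<in> carrier R" "n \<ge> (1::nat)" "x [^] n \<in> integral_closure R (M \<cdot> ideal_pow R I n)"
    using assms(3) unfolding integral_closure_sp_def by auto
  have C: "ideal (integral_closure R (M \<cdot> ideal_pow R I n)) R"
    using assms by (intro integral_closure_ideal ideal_prod_is_ideal ideal_pow_ideal)
  have "ideal_pow R (PIdl x) n \<subseteq> integral_closure R (M \<cdot> ideal_pow R I n)"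
    using ideal_pow_cgenideal_subset[OF x(1)] cgenideal_minimal[OF C x(3)] by (rule subset_trans)
  moreover have "PIdl x \<subseteq> integral_closure R I"
    using assms integral_closure_sp_subset[OF assms(1,2)] by (intro cgenideal_minimal integral_closure_ideal) auto
  moreover have "n = Suc (n - 1)" using x(2) by simp
  ultimately show ?thesis unfolding special_def by metis
qed

text \<open>In the power Suc i + Suc j of A + B every term has Suc i factors from \<open>A\<close>
  or Suc j from \<open>B\<close>, and these supply \<open>M\<close>. The remaining factors are
  absorbed because both ideals lie in the closure of \<open>I\<close>, which is why
  \<open>special\<close> includes that condition.\<close>

lemma special_add:
  assumes M: "ideal M R" and I: "ideal I R" and A: "ideal A R" and B: "ideal B R"
    and "special M I A" "special M I B"
  shows "special M I (A <+> B)"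
proof -
  let ?L = "A <+> B"
  note L = add_ideals[OF A B]
  have sub: "?L \<subseteq> integral_closure R I"
    using assms unfolding special_def by (subst set_add_subset_iff) (auto intro: integral_closure_ideal)
  obtain i j where i: "ideal_pow R A (Suc i) \<subseteq> integral_closure R (M \<cdot> ideal_pow R I (Suc i))"
    and j: "ideal_pow R B (Suc j) \<subseteq> integral_closure R (M \<cdot> ideal_pow R I (Suc j))"
    using assms unfolding special_def by auto
  let ?C = "integral_closure R (M \<cdot> ideal_pow R I (Suc i + Suc j))"
  have C: "ideal ?C R" using M I by (intro integral_closure_ideal ideal_prod_is_ideal ideal_pow_ideal)
  have 1: "ideal_pow R ?L (Suc j) \<cdot> ideal_pow R A (Suc i) \<subseteq> ?C"
  proof -
    have "ideal_pow R ?L (Suc j) \<cdot> ideal_pow R A (Suc i) = ideal_pow R A (Suc i) \<cdot> ideal_pow R ?L (Suc j)"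
      using A L by (intro ideal_prod_commute ideal_pow_ideal)
    also have "\<dots> \<subseteq> integral_closure R (M \<cdot> ideal_pow R I (Suc i)) \<cdot> ideal_pow R (integral_closure R I) (Suc j)"
      using i sub by (intro ideal_prod_mono ideal_pow_mono)
    also have "\<dots> \<subseteq> ?C"
      using M I by (rule integral_closure_prod_pow_subset)
    finally show ?thesis .
  qed
  have 2: "ideal_pow R ?L (Suc i) \<cdot> ideal_pow R B (Suc j) \<subseteq> ?C"
  proof -
    have "ideal_pow R ?L (Suc i) \<cdot> ideal_pow R B (Suc j) = ideal_pow R B (Suc j) \<cdot> ideal_pow R ?L (Suc i)"
      using B L by (intro ideal_prod_commute ideal_pow_ideal)
    also have "\<dots> \<subseteq> integral_closure R (M \<cdot> ideal_pow R I (Suc j)) \<cdot> ideal_pow R (integral_closure R I) (Suc i)"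
      using j sub by (intro ideal_prod_mono ideal_pow_mono)
    also have "\<dots> \<subseteq> integral_closure R (M \<cdot> ideal_pow R I (Suc j + Suc i))"
      using M I by (rule integral_closure_prod_pow_subset)
    also have "\<dots> = ?C" by (simp only: add.commute)
    finally show ?thesis .
  qed
  have "ideal_pow R ?L (Suc j) \<cdot> ideal_pow R A (Suc i) <+> ideal_pow R ?L (Suc i) \<cdot> ideal_pow R B (Suc j) \<subseteq> ?C"
    using 1 2 set_add_subset_iff[OF ideal_prod_is_ideal[OF ideal_pow_ideal[OF L] ideal_pow_ideal[OF A]]
        ideal_prod_is_ideal[OF ideal_pow_ideal[OF L] ideal_pow_ideal[OF B]] C] by blast
  then have "ideal_pow R ?L (Suc i + Suc j) \<subseteq> ?C"
    using ideal_pow_add_subset[OF A B, of "Suc i" "Suc j"] by (rule subset_trans[rotated])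
  then show ?thesis
    using sub unfolding special_def by (metis add_Suc)
qed

lemma integral_closure_sp_ideal:
  assumes M: "ideal M R" and I: "ideal I R"
  shows "ideal (integral_closure_sp R M I) R"
proof -
  let ?S = "integral_closure_sp R M I"
  have carr: "?S \<subseteq> carrier R" unfolding integral_closure_sp_def by auto
  have single: "PIdl x \<subseteq> ?S" if "x \<in> ?S" for x
    using special_subset_integral_closure_sp[OF special_cgenideal[OF M I that]] .
  show ?thesis
  proof (rule idealI[OF ring_axioms])
    show "subgroup ?S (add_monoid R)"
    proof (rule add.subgroupI)
      show "?S \<subseteq> carrier R" by (rule carr)
      show "?S \<noteq> {}"
        using prod_subset_integral_closure_sp[OF M I]
          additive_subgroup.zero_closed[OF ideal.axioms(1)[OF ideal_prod_is_ideal[OF M I]]] by auto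
    next
      fix a assume a: "a \<in> ?S"
      then have "\<ominus> a \<in> PIdl a"
        using carr cgenideal_self cgenideal_ideal additive_subgroup.a_inv_closed ideal.axioms(1) by (metis subsetD)
      then show "\<ominus> a \<in> ?S" using single[OF a] by auto
    next
      fix a b assume a: "a \<in> ?S" and b: "b \<in> ?S"
      then have c: "a \<in> carrier R" "b \<in> carrier R" using carr by auto
      note ids = cgenideal_ideal[OF c(1)] cgenideal_ideal[OF c(2)]
      have "a \<oplus> b \<in> PIdl a <+> PIdl b"
        unfolding set_add_def' using cgenideal_self c by blast
      then show "a \<oplus> b \<in> ?S"
        using special_subset_integral_closure_sp[OF special_add[OF M I ids special_cgenideal[OF M I a] special_cgenideal[OF M I b]]]
        by auto
    qed
  next
    fix a r assume a: "a \<in> ?S" and r: "r \<in> carrier R"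
    then have "a \<in> carrier R" using carr by auto
    then have "r \<otimes> a \<in> PIdl a" "a \<otimes> r \<in> PIdl a"
      using r cgenideal_self cgenideal_ideal ideal.I_l_closed ideal.I_r_closed by metis+
    then show "r \<otimes> a \<in> ?S" "a \<otimes> r \<in> ?S" using single[OF a] by auto
  qed
qed

lemma special_integral_closure_sp:
  assumes M: "ideal M R" and I: "ideal I R"
  shows "special M I (integral_closure_sp R M I)"
proof -
  let ?S = "integral_closure_sp R M I"
  have "special M I (Idl F)" if "finite F" "F \<subseteq> ?S" for F
    using that
  proof (induct F)
    case empty
    \<comment> \<open>The induction starts at the zero ideal, treated as the principal ideal of the
      element zero of \<open>?S\<close>.\<close>
    have zero: "\<zero> \<in> ?S"
      using integral_closure_sp_ideal[OF M I] by (simp add: additive_subgroup.zero_closed ideal.axioms(1))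
    have "Idl {} = {\<zero>}"
      using genideal_minimal[OF zeroideal, of "{}"] genideal_ideal[of "{}"]
        additive_subgroup.zero_closed[OF ideal.axioms(1)] by blast
    moreover have "PIdl \<zero> = {\<zero>}"
      using cgenideal_eq_genideal genideal_zero by simp
    ultimately show ?case
      using special_cgenideal[OF M I zero] by simp
  next
    case (insert x F)
    have F: "F \<subseteq> carrier R" and x: "x \<in> carrier R"
      using insert.prems unfolding integral_closure_sp_def by auto
    show ?case
      unfolding Idl_insert[OF x F]
      using special_add[OF M I genideal_ideal[OF F] cgenideal_ideal[OF x] insert.hyps(3) special_cgenideal[OF M I]] insert.prems
      by simp
  qed
  then show ?thesis
    using finetely_gen[OF integral_closure_sp_ideal[OF M I]] genideal_self by metis
qed

text \<open>With T the closure of S, a high power of T lies in S^(k+1) T^n. The first factor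
  supplies \<open>M\<close>, the second lies in a power of the closure of \<open>I\<close>, so T
  itself is special.\<close>

lemma integral_closure_integral_closure_sp:
  assumes M: "ideal M R" and I: "ideal I R"
  shows "integral_closure R (integral_closure_sp R M I) = integral_closure_sp R M I"
proof
  let ?S = "integral_closure_sp R M I"
  note S = integral_closure_sp_ideal[OF M I]
  let ?T = "integral_closure R ?S"
  note T = integral_closure_ideal[OF S]
  have sub: "?T \<subseteq> integral_closure R I"
    using integral_closure_least[OF I integral_closure_sp_subset[OF M I]] .
  obtain n where n: "ideal_pow R ?T (Suc n) \<subseteq> ?S \<cdot> ideal_pow R ?T n"
    using reduction_integral_closure[OF S] unfolding reduction_def by auto
  obtain k where k: "ideal_pow R ?S (Suc k) \<subseteq> integral_closure R (M \<cdot> ideal_pow R I (Suc k))"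
    using special_integral_closure_sp[OF M I] unfolding special_def by auto
  have "ideal_pow R ?T (Suc k + n) \<subseteq> ideal_pow R ?S (Suc k) \<cdot> ideal_pow R ?T n"
    using S T n by (rule reduction_pow_add)
  also have "\<dots> \<subseteq> integral_closure R (M \<cdot> ideal_pow R I (Suc k)) \<cdot> ideal_pow R (integral_closure R I) n"
    using k sub by (intro ideal_prod_mono ideal_pow_mono)
  also have "\<dots> \<subseteq> integral_closure R (M \<cdot> ideal_pow R I (Suc k + n))"
    using M I by (rule integral_closure_prod_pow_subset)
  finally have "special M I ?T"
    unfolding special_def using sub by (metis add_Suc)
  then show "?T \<subseteq> ?S" by (rule special_subset_integral_closure_sp)
  show "?S \<subseteq> ?T" using S by (rule subset_integral_closure)
qed

section \<open>Maximal ideals, Nakayama's lemma and condition (4)\<close>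

text \<open>Zorn's lemma, where a nonempty chain of ideals has its union as a member by the
  Noetherian property; so the union is again proper.\<close>

lemma exists_maximalideal:
  assumes "ideal I R" "I \<noteq> carrier R"
  obtains N where "maximalideal N R" "I \<subseteq> N"
proof -
  let ?A = "{J. ideal J R \<and> I \<subseteq> J \<and> J \<noteq> carrier R}"
  have "\<exists>N\<in>?A. \<forall>J\<in>?A. N \<subseteq> J \<longrightarrow> J = N"
  proof (rule subset_Zorn_nonempty)
    show "?A \<noteq> {}" using assms by auto
    fix C assume C: "C \<noteq> {}" "subset.chain ?A C"
    then have "subset.chain {J. ideal J R} C"
      unfolding pred_on.chain_def by blast
    then have "\<Union>C \<in> C" using C(1) by (intro ideal_chain_is_trivial)
    then show "\<Union>C \<in> ?A" using C(2) unfolding pred_on.chain_def by blast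
  qed
  then obtain N where N: "N \<in> ?A" and max: "\<forall>J\<in>?A. N \<subseteq> J \<longrightarrow> J = N" ..
  have "maximalideal N R"
  proof (rule maximalidealI)
    fix J assume "ideal J R" "N \<subseteq> J"
    then show "J = N \<or> J = carrier R" using N max by auto
  qed (use N in auto)
  then show ?thesis using N that by simp
qed

end

sublocale noetherian_local_ring \<subseteq> noetherian_cring ..

context noetherian_local_ring
begin

lemma max_ideal: "ideal \<mm> R"
  using maximalideal_max by (rule maximalideal.axioms)

text \<open>Otherwise 1 - a would lie in a maximal ideal, which can only be \<open>\<mm>\<close>,
  and then so would 1.\<close>

lemma Units_one_minus:
  assumes "a \<in> \<mm>"
  obtains b where "b \<in> carrier R" "b \<otimes> (\<one> \<ominus> a) = \<one>"
proof -
  have a: "a \<in> carrier R" using assms max_ideal ideal.Icarr by metis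
  have id: "ideal (PIdl (\<one> \<ominus> a)) R" using a by (intro cgenideal_ideal) simp
  have "PIdl (\<one> \<ominus> a) = carrier R"
  proof (rule ccontr)
    assume "PIdl (\<one> \<ominus> a) \<noteq> carrier R"
    with id obtain N where "maximalideal N R" "PIdl (\<one> \<ominus> a) \<subseteq> N"
      by (rule exists_maximalideal)
    then have "PIdl (\<one> \<ominus> a) \<subseteq> \<mm>" using maximalideal_unique by simp
    then have "\<one> \<ominus> a \<in> \<mm>" using cgenideal_self[of "\<one> \<ominus> a"] a by auto
    then have "(\<one> \<ominus> a) \<oplus> a \<in> \<mm>"
      using assms max_ideal by (simp add: additive_subgroup.a_closed ideal.axioms(1))
    moreover have "(\<one> \<ominus> a) \<oplus> a = \<one>" using a by (simp add: a_minus_def a_assoc l_neg)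
    ultimately have "\<mm> = carrier R" using ideal.one_imp_carrier[OF max_ideal] by simp
    then show False using maximalideal.I_notcarr[OF maximalideal_max] by simp
  qed
  then have "\<one> \<in> PIdl (\<one> \<ominus> a)" by simp
  then obtain b where "b \<in> carrier R" "\<one> = b \<otimes> (\<one> \<ominus> a)" by (auto simp: cgenideal_def)
  then show ?thesis using that by simp
qed

text \<open>Generators of K modulo X are discarded one by one. If m is among them, the hypothesis
  gives m = y + a m with a \<in> \<open>\<mm>\<close> and y in the ideal spanned by X and the
  others; 1 - a is invertible, so m is redundant.\<close>

lemma nakayama:
  assumes X: "ideal X R" and K: "ideal K R" and KX: "K \<subseteq> X <+> \<mm> \<cdot> K"
  shows "K \<subseteq> X"
proof -
  have "K \<subseteq> X" if "finite F" "F \<subseteq> K" "K \<subseteq> X <+> Idl F" for F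
    using that
  proof (induct F)
    case empty
    have "Idl {} \<subseteq> X" using X by (intro genideal_minimal) auto
    then have "X <+> Idl {} \<subseteq> X"
      using X genideal_ideal[of "{}"] by (simp add: set_add_subset_iff)
    then show ?case using empty by auto
  next
    case (insert m F)
    have F: "F \<subseteq> carrier R" and m: "m \<in> carrier R"
      using insert.prems K by (auto intro: ideal.Icarr)
    note ids = genideal_ideal[OF F] cgenideal_ideal[OF m]
    let ?Y = "X <+> Idl F"
    have Y: "ideal ?Y R" using X ids(1) by (rule add_ideals)
    note mK = ideal_prod_is_ideal[OF max_ideal K]
    have Yins: "X <+> Idl (insert m F) = ?Y <+> PIdl m"
      unfolding Idl_insert[OF m F] using X ids
      by (simp add: add.set_mult_assoc set_add_defs(1) additive_subgroup.a_subset ideal.axioms(1))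
    have "\<mm> \<cdot> K \<subseteq> \<mm> \<cdot> (?Y <+> PIdl m)"
      using insert.prems Yins by (intro ideal_prod_mono) auto
    also have "\<dots> = \<mm> \<cdot> ?Y <+> \<mm> \<cdot> (PIdl m)"
      using max_ideal Y ids(2) by (rule ideal_prod_distr)
    also have "\<dots> \<subseteq> ?Y <+> \<mm> \<cdot> (PIdl m)"
      using ideal_prod_subset(2)[OF max_ideal Y] by (rule set_add_mono[OF _ order_refl])
    finally have mKY: "\<mm> \<cdot> K \<subseteq> ?Y <+> \<mm> \<cdot> (PIdl m)" .
    note mm = ideal_prod_is_ideal[OF max_ideal ids(2)]
    have "X <+> \<mm> \<cdot> K \<subseteq> ?Y <+> \<mm> \<cdot> (PIdl m)"
      using mKY subset_trans[OF subset_set_add(1)[OF X ids(1)] subset_set_add(1)[OF Y mm]]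
        set_add_subset_iff[OF X mK add_ideals[OF Y mm]] by simp
    then have "m \<in> ?Y <+> \<mm> \<cdot> (PIdl m)"
      using KX insert.prems by auto
    then obtain y u where y: "y \<in> ?Y" and u: "u \<in> \<mm> \<cdot> (PIdl m)" and mu: "m = y \<oplus> u"
      by (rule mem_set_addE)
    obtain a where a: "a \<in> \<mm>" "u = a \<otimes> m"
      using mem_ideal_prod_cgenideal[OF max_ideal m u] by metis
    have c: "a \<in> carrier R" "y \<in> carrier R"
      using a y max_ideal Y ideal.Icarr by metis+
    obtain b where b: "b \<in> carrier R" "b \<otimes> (\<one> \<ominus> a) = \<one>"
      using Units_one_minus[OF a(1)] .
    have "(\<one> \<ominus> a) \<otimes> m = m \<ominus> u"
      using c m a by (simp add: a_minus_def l_distr l_minus)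
    also have "\<dots> = (y \<oplus> u) \<ominus> u" using mu by simp
    also have "\<dots> = y" using c m a by (simp add: a_minus_def a_assoc r_neg)
    finally have "m = b \<otimes> y"
      using b c m m_assoc[of b "\<one> \<ominus> a" m] by simp
    then have "m \<in> ?Y" using y b(1) Y by (simp add: ideal.I_l_closed)
    then have "?Y <+> PIdl m \<subseteq> ?Y"
      using Y ids(2) m by (simp add: set_add_subset_iff cgenideal_subset_iff)
    then show ?case using insert Yins by auto
  qed
  moreover obtain F where F: "F \<subseteq> carrier R" "finite F" "K = Idl F"
    using finetely_gen[OF K] by blast
  moreover have "F \<subseteq> K" using genideal_self F by simp
  moreover have "K \<subseteq> X <+> Idl F" using subset_set_add(2)[OF X K] F(3) by simp
  ultimately show ?thesis by blast
qed

lemma subset_integral_closure_of_special_part: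
  assumes J: "ideal J R" and I: "ideal I R" and JI: "J \<subseteq> I"
    and IJ: "I \<subseteq> integral_closure R (J <+> integral_closure_sp R \<mm> I)"
  shows "I \<subseteq> integral_closure R J"
proof -
  let ?S = "integral_closure_sp R \<mm> I" and ?K = "integral_closure R I"
  note M = max_ideal
  note S = integral_closure_sp_ideal[OF M I] and K = integral_closure_ideal[OF I]
  let ?JS = "J <+> ?S"
  note JS = add_ideals[OF J S]
  have IK: "I \<subseteq> ?K" using I by (rule subset_integral_closure)
  have JSK: "?JS \<subseteq> ?K"
    using JI IK integral_closure_sp_subset[OF M I] J S K by (auto simp: set_add_subset_iff)
  \<comment> \<open>The hypothesis on \<open>I\<close> gives one inclusion, \<open>JSK\<close> the
    other; so J + S is a reduction of K.\<close>
  have "?K = integral_closure R ?JS"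
    using integral_closure_least[OF JS IJ] integral_closure_least[OF I JSK] by blast
  then obtain n where n: "ideal_pow R ?K (Suc n) \<subseteq> ?JS \<cdot> ideal_pow R ?K n"
    using reduction_integral_closure[OF JS] unfolding reduction_def by auto
  obtain k where k: "ideal_pow R ?S (Suc k) \<subseteq> integral_closure R (\<mm> \<cdot> ideal_pow R I (Suc k))"
    using special_integral_closure_sp[OF M I] unfolding special_def by auto
  \<comment> \<open>Q = Suc q = Suc k + n: Suc k factors are to come from J + S, where
    \<open>?S\<close> to the power Suc k supplies \<open>\<mm>\<close>, and K^n is the remainder
    that the reduction leaves.\<close>
  define q where "q = k + n"
  define U where "U = ideal_pow R ?K (Suc q)"
  define D where "D = integral_closure R (\<mm> \<cdot> ideal_pow R I (Suc q))"
  define A where "A = J \<cdot> ideal_pow R ?K q"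
  define E where "E = integral_closure R (ideal_pow R I (Suc q))"
  define P where "P = ideal_pow R I (Suc q)"
  note PI = ideal_pow_ideal[OF I] and PK = ideal_pow_ideal[OF K]
  have P: "ideal P R" unfolding P_def using PI .
  have MP: "ideal (\<mm> \<cdot> P) R" using M P by (rule ideal_prod_is_ideal)
  have U: "ideal U R" unfolding U_def using PK .
  have D: "ideal D R" unfolding D_def using MP unfolding P_def by (rule integral_closure_ideal)
  have A: "ideal A R" unfolding A_def using J PK by (rule ideal_prod_is_ideal)
  have E: "ideal E R" unfolding E_def using PI by (rule integral_closure_ideal)
  have PU: "P \<subseteq> U" unfolding P_def U_def using IK by (rule ideal_pow_mono)
  have UE: "U \<subseteq> E" unfolding U_def E_def using I by (rule integral_closure_pow)
  have DE: "D \<subseteq> E"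
    unfolding D_def E_def using ideal_prod_subset(2)[OF M PI] by (rule integral_closure_mono)
  have AE: "A \<subseteq> E"
  proof -
    have "A \<subseteq> ?K \<cdot> ideal_pow R ?K q"
      unfolding A_def using JI IK by (intro ideal_prod_mono) auto
    also have "\<dots> = U"
      unfolding U_def using K PK by (simp add: ideal_prod_commute)
    finally show ?thesis using UE by simp
  qed

  \<comment> \<open>Expanding (J + S)^(k+1), the terms with a factor from \<open>J\<close> go into
    \<open>A\<close>, while S^(k+1) K^n goes into \<open>D\<close>.\<close>
  have UAD: "U \<subseteq> A <+> D"
  proof -
    have AD: "ideal (A <+> D) R" using A D by (rule add_ideals)
    have "ideal_pow R ?K (Suc k + n) \<subseteq> ideal_pow R ?JS (Suc k) \<cdot> ideal_pow R ?K n"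
      using JS K n by (rule reduction_pow_add)
    also have "\<dots> \<subseteq> (ideal_pow R ?JS k \<cdot> J <+> ideal_pow R ?S (Suc k)) \<cdot> ideal_pow R ?K n"
      using ideal_pow_add_Suc_subset[OF J S] by (intro ideal_prod_mono order_refl)
    also have "\<dots> = (ideal_pow R ?JS k \<cdot> J) \<cdot> ideal_pow R ?K n <+> ideal_pow R ?S (Suc k) \<cdot> ideal_pow R ?K n"
      using PK ideal_prod_is_ideal[OF ideal_pow_ideal[OF JS] J] ideal_pow_ideal[OF S] by (rule ideal_prod_distr(2))
    also have "\<dots> \<subseteq> A <+> D"
    proof -
      have "(ideal_pow R ?JS k \<cdot> J) \<cdot> ideal_pow R ?K n \<subseteq> (ideal_pow R ?K k \<cdot> J) \<cdot> ideal_pow R ?K n"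
        using JSK by (intro ideal_prod_mono ideal_pow_mono order_refl)
      also have "\<dots> = A"
        unfolding A_def q_def using J K PK by (simp add: ideal_pow_add ideal_prod_ac ideal_prod_is_ideal)
      finally have "(ideal_pow R ?JS k \<cdot> J) \<cdot> ideal_pow R ?K n \<subseteq> A" .
      moreover have "ideal_pow R ?S (Suc k) \<cdot> ideal_pow R ?K n \<subseteq> D"
      proof -
        have "ideal_pow R ?S (Suc k) \<cdot> ideal_pow R ?K n
            \<subseteq> integral_closure R (\<mm> \<cdot> ideal_pow R I (Suc k)) \<cdot> ideal_pow R ?K n"
          using k by (intro ideal_prod_mono order_refl)
        also have "\<dots> \<subseteq> integral_closure R (\<mm> \<cdot> ideal_pow R I (Suc k + n))"
          using M I by (rule integral_closure_prod_pow_subset)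
        finally show ?thesis by (simp only: D_def q_def add_Suc)
      qed
      ultimately show ?thesis by (rule set_add_mono)
    qed
    finally show ?thesis by (simp only: U_def q_def add_Suc)
  qed

  obtain p where p: "ideal_pow R D (Suc p) \<subseteq> (\<mm> \<cdot> P) \<cdot> ideal_pow R D p"
    using reduction_integral_closure[OF MP] unfolding reduction_def D_def P_def by auto
  obtain r where r: "ideal_pow R E (Suc r) \<subseteq> P \<cdot> ideal_pow R E r"
    using reduction_integral_closure[OF P] unfolding reduction_def E_def P_def by auto
  note PE = ideal_pow_ideal[OF E] and PU' = ideal_pow_ideal[OF U]
  \<comment> \<open>\<open>V\<close> is made to absorb E^p E^r, and K^q in \<open>W\<close> is
    chosen so that K W = U V and J W = A V. The inclusion for U thereby becomes one for K.\<close>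
  define V where "V = ideal_pow R U p \<cdot> ideal_pow R E r"
  define W where "W = ideal_pow R ?K q \<cdot> V"
  have V: "ideal V R" unfolding V_def using PU' PE by (rule ideal_prod_is_ideal)
  have W: "ideal W R" unfolding W_def using PK V by (rule ideal_prod_is_ideal)
  have KW: "?K \<cdot> W = U \<cdot> V"
    unfolding W_def U_def using K PK V by (simp add: ideal_prod_ac)
  have AV: "A \<cdot> V = J \<cdot> W"
    unfolding W_def A_def using J PK V by (rule ideal_prod_assoc)
  have EV: "ideal_pow R E p \<cdot> ideal_pow R E r \<subseteq> V"
  proof -
    have "ideal_pow R E p \<cdot> ideal_pow R E r = ideal_pow R E (p + r)"
      using E by (simp only: ideal_pow_add)
    also have "\<dots> \<subseteq> ideal_pow R P p \<cdot> ideal_pow R E r"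
      using P E r by (rule reduction_pow_add)
    also have "\<dots> \<subseteq> V"
      unfolding V_def using PU by (intro ideal_prod_mono ideal_pow_mono order_refl)
    finally show ?thesis .
  qed
  have "U \<cdot> V = ideal_pow R U (Suc p) \<cdot> ideal_pow R E r"
    unfolding V_def using U PU' PE by (simp add: ideal_prod_ac)
  also have "\<dots> \<subseteq> (ideal_pow R (A <+> D) p \<cdot> A <+> ideal_pow R D (Suc p)) \<cdot> ideal_pow R E r"
    using ideal_pow_mono[OF UAD, of "Suc p"] ideal_pow_add_Suc_subset[OF A D, of p]
    by (intro ideal_prod_mono order_refl) (rule subset_trans)
  \<comment> \<open>In the first summand everything but \<open>A\<close> is enlarged to E^p. In the
    second, the reduction of \<open>D\<close> yields the factor \<open>\<mm>\<close> P, and D^p is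
    enlarged to E^p as well.\<close>
  also have "\<dots> \<subseteq> (A \<cdot> ideal_pow R E p <+> (\<mm> \<cdot> P) \<cdot> ideal_pow R E p) \<cdot> ideal_pow R E r"
  proof -
    have "A <+> D \<subseteq> E" using A D E AE DE by (simp add: set_add_subset_iff)
    then have "ideal_pow R (A <+> D) p \<cdot> A \<subseteq> A \<cdot> ideal_pow R E p"
      using ideal_prod_commute[OF PE A] ideal_prod_mono[OF ideal_pow_mono order_refl] by metis
    moreover have "ideal_pow R D (Suc p) \<subseteq> (\<mm> \<cdot> P) \<cdot> ideal_pow R E p"
      using p ideal_prod_mono[OF order_refl ideal_pow_mono[OF DE]] by (rule subset_trans)
    ultimately show ?thesis
      by (rule ideal_prod_mono[OF set_add_mono order_refl])
  qed
  also have "\<dots> = A \<cdot> (ideal_pow R E p \<cdot> ideal_pow R E r) <+> (\<mm> \<cdot> P) \<cdot> (ideal_pow R E p \<cdot> ideal_pow R E r)"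
    using A MP PE by (simp add: ideal_prod_distr ideal_prod_is_ideal ideal_prod_assoc)
  \<comment> \<open>Replacing \<open>P\<close> by the larger \<open>U\<close> makes the second
    summand \<open>\<mm>\<close> times the left-hand side, the shape that Nakayama's lemma
    requires.\<close>
  also have "\<dots> \<subseteq> A \<cdot> V <+> (\<mm> \<cdot> U) \<cdot> V"
    using EV PU by (intro set_add_mono ideal_prod_mono order_refl)
  also have "\<dots> = J \<cdot> W <+> \<mm> \<cdot> (?K \<cdot> W)"
    unfolding AV KW using M U V by (simp add: ideal_prod_assoc)
  finally have "?K \<cdot> W \<subseteq> J \<cdot> W <+> \<mm> \<cdot> (?K \<cdot> W)"
    unfolding KW .
  then have KJ: "?K \<cdot> W \<subseteq> J \<cdot> W"
    by (rule nakayama[OF ideal_prod_is_ideal[OF J W] ideal_prod_is_ideal[OF K W]])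
  show ?thesis
  proof
    fix z assume "z \<in> I"
    then have zK: "z \<in> ?K" using IK by auto
    then have z: "z \<in> carrier R" using K ideal.Icarr by metis
    \<comment> \<open>The power of z in \<open>W\<close> is assembled from z^q in K^q, p copies of
      z^(q+1) in \<open>U\<close> and r copies of it in \<open>E\<close>.\<close>
    have "z [^] (Suc q) \<in> U"
      unfolding U_def using zK by (rule nat_pow_mem_ideal_pow)
    then have "(z [^] Suc q) [^] p \<in> ideal_pow R U p" "(z [^] Suc q) [^] r \<in> ideal_pow R E r"
      using UE by (auto intro!: nat_pow_mem_ideal_pow)
    then have "z [^] (Suc q * p) \<otimes> z [^] (Suc q * r) \<in> V"
      unfolding V_def nat_pow_pow[OF z] by (rule ideal_prod.prod)
    then have "z [^] q \<otimes> (z [^] (Suc q * p) \<otimes> z [^] (Suc q * r)) \<in> W"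
      unfolding W_def using nat_pow_mem_ideal_pow[OF zK, of q] by (intro ideal_prod.prod)
    then have "z [^] (q + (Suc q * p + Suc q * r)) \<in> W"
      using nat_pow_mult[OF z] by simp
    moreover have "z \<otimes> y \<in> J \<cdot> W" if "y \<in> W" for y
      using KJ ideal_prod.prod[OF zK that, of R] by auto
    ultimately show "z \<in> integral_closure R J"
      using mem_integral_closure_of_module[OF J z W] by blast
  qed
qed

end

theorem proposition5p7:
  fixes R :: "('a, 'b) ring_scheme" and \<mm> :: "'a set"
  assumes "noetherian_local_ring R \<mm>"
  shows "special_part R \<mm> (integral_closure R) (integral_closure_sp R \<mm>)"
proof -
  interpret noetherian_local_ring R \<mm> by (rule assms)
  show ?thesis
    unfolding special_part_def
    using max_ideal integral_closure_sp_ideal prod_subset_integral_closure_sp integral_closure_sp_subset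
      integral_closure_sp_integral_closure integral_closure_integral_closure_sp
      subset_integral_closure_of_special_part
    by simp
qed

end
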